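(* For every dag $\mathcal{G}$, the edge labels resulting from running Algorithm Find-Compelled on $\mathcal{G}$ are correct: every edge labelled "compelled" in the output is compelled in $\mathcal{G}$, and every edge labelled "reversible" in the output is reversible in $\mathcal{G}$.
   Context: All graphs have the same finite vertex set $U=\{x_1,\dots,x_n\}$; a dag $\mathcal{G}=(U,E_{\mathcal{G}})$ is an acyclic directed graph. Each node $x_i$ is a discrete variable with a finite number $r_i\ge 2$ of states. A Bayesian network with structure $\mathcal{G}$ is a pair $(\mathcal{G},\theta_{\mathcal{G}})$ where $\theta_{\mathcal{G}}$ is a collection of conditional distributions of each node given its parents in $\mathcal{G}$; it defines the joint distribution that is the product of these. Two dags are equivalent, written $\mathcal{G}\approx\mathcal{G}'$, if for every Bayesian network $(\mathcal{G},\theta_{\mathcal{G}})$ there is a Bayesian network $(\mathcal{G}',\theta_{\mathcal{G}'})$ defining the same joint distribution, and vice versa. Known fact (Verma and Pearl): $\mathcal{G}\approx\mathcal{G}'$ if and only if they have the same skeleton (underlying undirected graph) and the same v-structures (ordered triples $(x,y,z)$ of distinct nodes with $x\to y$, $z\to y$ and $x,z$ not adjacent). An edge $x\to y\in E_{\mathcal{G}}$ is compelled in $\mathcal{G}$ if $x\to y\in E_{\mathcal{G}'}$ for every dag $\mathcal{G}'\approx\mathcal{G}$; otherwise it is reversible in $\mathcal{G}$ (i.e. it has the opposite orientation in some dag equivalent to $\mathcal{G}$). An edge is incident into $y$ if it has the form $z\to y$. A topological sort of $\mathcal{G}$ is a total order of the nodes in which ancestors precede descendants. Algorithm Order-Edges($\mathcal{G}$):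 1. Perform a topological sort on the nodes of $\mathcal{G}$ (any choice). 2. Set $i=0$. 3. While there are unordered edges in $\mathcal{G}$: 4. let $y$ be the lowest ordered node that has an unordered edge incident into it; 5. let $x$ be the highest ordered node for which $x\to y$ is an edge that is not ordered; 6. label $x\to y$ with order $i$; 7. $i=i+1$. Algorithm Find-Compelled($\mathcal{G}$): 1. Order the edges of $\mathcal{G}$ using Order-Edges. 2. Label every edge "unknown". 3. While there are edges labelled "unknown": 4. Let $x\to y$ be the lowest ordered edge labelled "unknown". 5. For every edge $w\to x$ labelled "compelled": 6. if $w$ is not a parent of $y$, then label $x\to y$ and every edge incident into $y$ with "compelled" and go to Step 3; 7. else label $w\to y$ with "compelled". 8. (After the loop of Step 5.) If there exists an edge $z\to y$ such that $z\ne x$ and $z$ is not a parent of $x$, then label $x\to y$ and all "unknown" edges incident into $y$ with "compelled"; 9. else label $x\to y$ and all "unknown" edges incident into $y$ with "reversible". *)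

theory Defs
  imports "HOL-Probability.Probability_Mass_Function" "HOL-Library.While_Combinator"
begin

definition dag :: "'a set \<Rightarrow> ('a \<times> 'a) set \<Rightarrow> bool" where
  "dag U E \<longleftrightarrow> E \<subseteq> U \<times> U \<and> acyclic E"

definition parents :: "('a \<times> 'a) set \<Rightarrow> 'a \<Rightarrow> 'a set" where
  "parents E y = {x. (x, y) \<in> E}"

(* The states of node x are 0, ..., r x - 1. *)
definition configs :: "('a \<Rightarrow> nat) \<Rightarrow> 'a set \<Rightarrow> ('a \<Rightarrow> nat) set" where
  "configs r A = PiE A (\<lambda>x. {..<r x})"

(* t x c is the conditional distribution of x given the configuration c of its parents. *)
definition bayes_net ::
  "'a set \<Rightarrow> ('a \<Rightarrow> nat) \<Rightarrow> ('a \<times> 'a) set \<Rightarrow> ('a \<Rightarrow> ('a \<Rightarrow> nat) \<Rightarrow> nat pmf) \<Rightarrow> bool" where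
  "bayes_net U r E t \<longleftrightarrow> dag U E \<and>
     (\<forall>x\<in>U. \<forall>c\<in>configs r (parents E x). set_pmf (t x c) \<subseteq> {..<r x})"

definition joint ::
  "'a set \<Rightarrow> ('a \<times> 'a) set \<Rightarrow> ('a \<Rightarrow> ('a \<Rightarrow> nat) \<Rightarrow> nat pmf) \<Rightarrow> ('a \<Rightarrow> nat) \<Rightarrow> real" where
  "joint U E t s = (\<Prod>x\<in>U. pmf (t x (restrict s (parents E x))) (s x))"

definition dag_equiv :: "'a set \<Rightarrow> ('a \<Rightarrow> nat) \<Rightarrow> ('a \<times> 'a) set \<Rightarrow> ('a \<times> 'a) set \<Rightarrow> bool" where
  "dag_equiv U r E E' \<longleftrightarrow> dag U E \<and> dag U E' \<and>
     (\<forall>t. bayes_net U r E t \<longrightarrow>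
        (\<exists>t'. bayes_net U r E' t' \<and> (\<forall>s\<in>configs r U. joint U E t s = joint U E' t' s))) \<and>
     (\<forall>t'. bayes_net U r E' t' \<longrightarrow>
        (\<exists>t. bayes_net U r E t \<and> (\<forall>s\<in>configs r U. joint U E t s = joint U E' t' s)))"

definition compelled :: "'a set \<Rightarrow> ('a \<Rightarrow> nat) \<Rightarrow> ('a \<times> 'a) set \<Rightarrow> 'a \<times> 'a \<Rightarrow> bool" where
  "compelled U r E e \<longleftrightarrow> e \<in> E \<and> (\<forall>E'. dag U E' \<and> dag_equiv U r E E' \<longrightarrow> e \<in> E')"

definition reversible :: "'a set \<Rightarrow> ('a \<Rightarrow> nat) \<Rightarrow> ('a \<times> 'a) set \<Rightarrow> 'a \<times> 'a \<Rightarrow> bool" where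
  "reversible U r E e \<longleftrightarrow> e \<in> E \<and> \<not> compelled U r E e"

(* A total order of the nodes is given as a list, lowest node first. *)
definition topological_sort :: "'a set \<Rightarrow> ('a \<times> 'a) set \<Rightarrow> 'a list \<Rightarrow> bool" where
  "topological_sort U E ts \<longleftrightarrow> distinct ts \<and> set ts = U \<and>
     (\<forall>i<length ts. \<forall>j<length ts. (ts ! i, ts ! j) \<in> E\<^sup>+ \<longrightarrow> i < j)"

(* An edge that is not yet ordered is mapped to None. *)
definition order_edges :: "('a \<times> 'a) set \<Rightarrow> 'a list \<Rightarrow> ('a \<times> 'a \<Rightarrow> nat option)" where
  "order_edges E ts = snd (while
     (\<lambda>(i, rank). \<exists>e\<in>E. rank e = None)
     (\<lambda>(i, rank).
        let y = hd (filter (\<lambda>y. \<exists>x. (x, y) \<in> E \<and> rank (x, y) = None) ts);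
            x = last (filter (\<lambda>x. (x, y) \<in> E \<and> rank (x, y) = None) ts)
        in (i + 1, rank((x, y) \<mapsto> i)))
     (0, Map.empty))"

datatype label = Unknown | Compelled | Reversible

type_synonym 'a labelling = "'a \<times> 'a \<Rightarrow> label"

definition relabel :: "('a \<times> 'a) set \<Rightarrow> label \<Rightarrow> 'a labelling \<Rightarrow> 'a labelling" where
  "relabel S l L = (\<lambda>e. if e \<in> S then l else L e)"

definition edges_into :: "('a \<times> 'a) set \<Rightarrow> 'a \<Rightarrow> ('a \<times> 'a) set" where
  "edges_into E y = {e \<in> E. snd e = y}"

(* The treatment of one edge (x, y). The list holds the nodes w, with w -> x labelled compelled,
   that the loop over these edges has still to visit. The first branch of the second equation
   leaves that loop and continues with the next unknown edge. *)
fun process_edge ::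
  "('a \<times> 'a) set \<Rightarrow> 'a \<Rightarrow> 'a \<Rightarrow> 'a list \<Rightarrow> 'a labelling \<Rightarrow> 'a labelling" where
  "process_edge E x y [] L =
     relabel (insert (x, y) {e \<in> edges_into E y. L e = Unknown})
       (if \<exists>z. (z, y) \<in> E \<and> z \<noteq> x \<and> (z, x) \<notin> E then Compelled else Reversible) L"
| "process_edge E x y (w # ws) L =
     (if (w, y) \<notin> E then relabel (insert (x, y) (edges_into E y)) Compelled L
      else process_edge E x y ws (relabel {(w, y)} Compelled L))"

(* The algorithm leaves open the topological sort ts and the order in which the inner loop visits
   the edges w -> x. The latter is fixed by scan, which lists all nodes, possibly differently for
   each edge (x, y) being treated; as each edge is treated at most once, every execution arises
   from some ts and scan. Labels of edges into x do not change during the inner loop, so the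
   edges to visit can be collected before it. *)
definition find_compelled ::
  "('a \<times> 'a) set \<Rightarrow> 'a list \<Rightarrow> ('a \<times> 'a \<Rightarrow> 'a list) \<Rightarrow> 'a labelling" where
  "find_compelled E ts scan =
     (let rank = order_edges E ts in
      while
        (\<lambda>L. \<exists>e\<in>E. L e = Unknown)
        (\<lambda>L. let (x, y) = arg_min_on (\<lambda>e. the (rank e)) {e \<in> E. L e = Unknown} in
           process_edge E x y (filter (\<lambda>w. (w, x) \<in> E \<and> L (w, x) = Compelled) (scan (x, y))) L)
        (\<lambda>e. Unknown))"

end

theory Submission
  imports Defs
begin

text \<open>Equivalence of dags amounts to equality of skeletons and v-structures. If these agree,
  an edge x \<rightarrow> y of one dag that is reversed in the other, with y minimal and then x maximal, is
  covered, that is, y has the parents of x and x itself as its parents. Reversing a covered edge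
  preserves the represented distributions by Bayes' rule, and it brings the two dags closer to each
  other. Conversely, a fair coin and its copy detect adjacency, and two fair coins and their parity
  detect v-structures.

  For a node y let C(y) be the set of nodes w such that w \<rightarrow> y is labelled compelled. If C(y) is
  nonempty, it contains a highest h for which either C(y) has a member not adjacent to h, or C(h) has a
  member that is not a parent of y. This persists when C(y) is copied from C(x), and it prevents
  every dag with the same skeleton and v-structures from reversing an edge w \<rightarrow> y with w \<in> C(y).

  The edges labelled reversible form a chordal graph on whose components C is constant. Any
  node b of a chordal graph comes first in some perfect elimination order, and directing the
  reversible edges along it creates neither a cycle nor a v-structure, while every edge at b leaves b.\<close>

section \<open>Compelled edges in Markov equivalent dags\<close>

definition skeleton :: "('a \<times> 'a) set \<Rightarrow> ('a \<times> 'a) set" where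
  "skeleton E = E \<union> E\<inverse>"

definition v_structures :: "('a \<times> 'a) set \<Rightarrow> ('a \<times> 'a \<times> 'a) set" where
  "v_structures E = {(x, y, z). (x, y) \<in> E \<and> (z, y) \<in> E \<and> x \<noteq> z \<and> (x, z) \<notin> skeleton E}"

lemma skeleton_iff: "(x, y) \<in> skeleton E \<longleftrightarrow> (x, y) \<in> E \<or> (y, x) \<in> E"
  by (auto simp: skeleton_def)

lemma v_structures_iff:
  "(x, y, z) \<in> v_structures E \<longleftrightarrow>
     (x, y) \<in> E \<and> (z, y) \<in> E \<and> x \<noteq> z \<and> (x, z) \<notin> skeleton E"
  by (simp add: v_structures_def)

lemma acyclic_no_loop: "acyclic E \<Longrightarrow> (a, a) \<notin> E"
  by (auto simp: acyclic_def)

lemma acyclic_no_2cycle: "acyclic E \<Longrightarrow> (a, b) \<in> E \<Longrightarrow> (b, a) \<notin> E"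
  by (meson acyclic_def r_into_trancl' trancl_trans)

lemma acyclic_no_3cycle: "acyclic E \<Longrightarrow> (a, b) \<in> E \<Longrightarrow> (b, c) \<in> E \<Longrightarrow> (c, a) \<notin> E"
  by (meson acyclic_def r_into_trancl' trancl_trans)

section \<open>Compelled edges keep their direction in Markov equivalent dags\<close>

text \<open>The relation between edges and compelled edges C which the algorithm establishes: x is the
  highest parent of y; either steps 6 or 8 apply at y, or only step 7 does.\<close>

definition labelled :: "('a \<times> 'a) set \<Rightarrow> ('a \<times> 'a) set \<Rightarrow> bool" where
  "labelled E C \<longleftrightarrow> C \<subseteq> E \<and> (\<forall>y. parents E y \<noteq> {} \<longrightarrow>
     (\<exists>x. (x, y) \<in> E \<and> (\<forall>z. (z, y) \<in> E \<longrightarrow> (x, z) \<notin> E) \<and>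
       ((\<forall>z. (z, y) \<in> E \<longrightarrow> (z, y) \<in> C) \<and>
          ((\<exists>w. (w, x) \<in> C \<and> (w, y) \<notin> E) \<or> (\<exists>z. (z, y) \<in> E \<and> z \<noteq> x \<and> (z, x) \<notin> E)) \<or>
        (\<forall>w. (w, y) \<in> C \<longleftrightarrow> (w, x) \<in> C) \<and> (\<forall>z. (z, y) \<in> E \<and> z \<noteq> x \<longrightarrow> (z, x) \<in> E))))"

lemma labelledE:
  assumes "labelled E C" "(v, y) \<in> E"
  obtains (all) x where "(x, y) \<in> E" "\<And>z. (z, y) \<in> E \<Longrightarrow> (x, z) \<notin> E"
      "\<And>z. (z, y) \<in> E \<Longrightarrow> (z, y) \<in> C"
      "(\<exists>w. (w, x) \<in> C \<and> (w, y) \<notin> E) \<or> (\<exists>z. (z, y) \<in> E \<and> z \<noteq> x \<and> (z, x) \<notin> E)"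
    | (inherit) x where "(x, y) \<in> E" "\<And>z. (z, y) \<in> E \<Longrightarrow> (x, z) \<notin> E"
      "\<And>w. (w, y) \<in> C \<longleftrightarrow> (w, x) \<in> C"
      "\<And>z. (z, y) \<in> E \<Longrightarrow> z \<noteq> x \<Longrightarrow> (z, x) \<in> E"
proof -
  have "parents E y \<noteq> {}" using assms(2) by (auto simp: parents_def)
  then obtain x where x: "(x, y) \<in> E" "\<And>z. (z, y) \<in> E \<Longrightarrow> (x, z) \<notin> E"
    and step: "(\<forall>z. (z, y) \<in> E \<longrightarrow> (z, y) \<in> C) \<and>
        ((\<exists>w. (w, x) \<in> C \<and> (w, y) \<notin> E) \<or> (\<exists>z. (z, y) \<in> E \<and> z \<noteq> x \<and> (z, x) \<notin> E)) \<or>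
      (\<forall>w. (w, y) \<in> C \<longleftrightarrow> (w, x) \<in> C) \<and> (\<forall>z. (z, y) \<in> E \<and> z \<noteq> x \<longrightarrow> (z, x) \<in> E)"
    using assms(1) unfolding labelled_def by blast
  from step show thesis
  proof (rule disjE, goal_cases)
    case 1
    then show thesis using all[OF x] by blast
  next
    case 2
    then show thesis using inherit[OF x] by blast
  qed
qed

text \<open>Induction along the edges. Where steps 6 or 8 apply, the highest parent x of y serves as
  h. Otherwise h is taken over from x: a node u with u \<rightarrow> h that is no parent of x is no
  parent of y either, because the parents of y other than x are parents of x, and u = x would form a
  2-cycle with h.\<close>

lemma labelled_witness:
  assumes lab: "labelled E C" and wf: "wf E" and ac: "acyclic E"
  shows "(v, y) \<in> C \<Longrightarrow> \<exists>h. (h, y) \<in> C \<and> (\<forall>w. (w, y) \<in> C \<longrightarrow> (h, w) \<notin> E) \<and>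
    ((\<exists>u. (u, h) \<in> C \<and> (u, y) \<notin> E) \<or> (\<exists>z. (z, y) \<in> C \<and> z \<noteq> h \<and> (z, h) \<notin> skeleton E))"
  using wf
proof (induction y arbitrary: v)
  case (less y)
  have CE: "C \<subseteq> E" using lab by (simp add: labelled_def)
  with less.prems have "(v, y) \<in> E" by blast
  with lab show ?case
  proof (cases rule: labelledE)
    case (all x)
    from all(4) have "(\<exists>u. (u, x) \<in> C \<and> (u, y) \<notin> E) \<or>
        (\<exists>z. (z, y) \<in> C \<and> z \<noteq> x \<and> (z, x) \<notin> skeleton E)"
      using all(2,3) unfolding skeleton_iff by blast
    then show ?thesis using all(1-3) CE by blast
  next
    case (inherit x)
    from less.prems inherit(3) have "(v, x) \<in> C" by blast
    from less.IH[OF inherit(1) this] obtain h where h: "(h, x) \<in> C" "\<forall>w. (w, x) \<in> C \<longrightarrow> (h, w) \<notin> E"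
      "(\<exists>u. (u, h) \<in> C \<and> (u, x) \<notin> E) \<or> (\<exists>z. (z, x) \<in> C \<and> z \<noteq> h \<and> (z, h) \<notin> skeleton E)" by blast
    have "(u, y) \<notin> E" if "(u, h) \<in> C" "(u, x) \<notin> E" for u
      using that inherit(4) h(1) CE acyclic_no_2cycle[OF ac] by blast
    then show ?thesis using h inherit(3) by blast
  qed
qed

text \<open>Were w \<rightarrow> y reversed in \<open>E'\<close>, the node h from
  \<open>labelled_witness\<close> would force a v-structure at w in \<open>E'\<close> that E cannot
  have. Induction along E supplies the direction of u \<rightarrow> h in \<open>E'\<close>.\<close>

lemma labelled_sound:
  assumes lab: "labelled E C" and wf: "wf E" and ac: "acyclic E" and ac': "acyclic E'"
    and sk: "skeleton E = skeleton E'" and vs: "v_structures E = v_structures E'"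
  shows "(w, y) \<in> C \<Longrightarrow> (w, y) \<in> E'"
  using wf
proof (induction y arbitrary: w)
  case (less y)
  have CE: "C \<subseteq> E" using lab by (simp add: labelled_def)
  have adj: "(a, b) \<in> skeleton E \<longleftrightarrow> (a, b) \<in> E' \<or> (b, a) \<in> E'" for a b
    by (simp add: sk skeleton_iff)
  have edge: "(a, b) \<in> E' \<or> (b, a) \<in> E'" if "(a, b) \<in> E" for a b
    using that adj[of a b] by (simp add: skeleton_iff)
  have v: "(a, b) \<in> E \<and> (c, b) \<in> E \<longleftrightarrow> (a, b) \<in> E' \<and> (c, b) \<in> E'"
    if "(a, c) \<notin> skeleton E" "a \<noteq> c" for a b c
  proof -
    have "(a, b, c) \<in> v_structures E \<longleftrightarrow> (a, b, c) \<in> v_structures E'" by (simp add: vs)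
    then show ?thesis using that sk by (simp add: v_structures_iff)
  qed
  obtain h where h: "(h, y) \<in> C" "\<And>w. (w, y) \<in> C \<Longrightarrow> (h, w) \<notin> E"
    and hw: "(\<exists>u. (u, h) \<in> C \<and> (u, y) \<notin> E) \<or> (\<exists>z. (z, y) \<in> C \<and> z \<noteq> h \<and> (z, h) \<notin> skeleton E)"
    using labelled_witness[OF lab wf ac less.prems] by blast
  have hyE: "(h, y) \<in> E" and wyE: "(w, y) \<in> E" using h(1) less.prems CE by auto
  show ?case
  proof (rule ccontr)
    assume "(w, y) \<notin> E'"
    then have yw: "(y, w) \<in> E'" using edge[OF wyE] by blast
    from hw show False
    proof
      assume "\<exists>u. (u, h) \<in> C \<and> (u, y) \<notin> E"
      then obtain u where u: "(u, h) \<in> C" "(u, y) \<notin> E" by blast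
      have uh: "(u, h) \<in> E'" using less.IH[OF hyE u(1)] .
      have "(y, u) \<notin> E" using acyclic_no_3cycle[OF ac, of u h y] u CE hyE by blast
      then have uy: "(u, y) \<notin> skeleton E" using u by (simp add: skeleton_iff)
      have "u \<noteq> y" using u(1) hyE CE acyclic_no_2cycle[OF ac] by blast
      have "(y, h) \<notin> E'"
        using v[OF uy \<open>u \<noteq> y\<close>, of h] uh hyE acyclic_no_2cycle[OF ac] by blast
      then have hy: "(h, y) \<in> E'" using edge[OF hyE] by blast
      have "w \<noteq> h" using hy \<open>(w, y) \<notin> E'\<close> by blast
      have "(w, h) \<in> skeleton E" using v[of w h y] \<open>w \<noteq> h\<close> hyE wyE \<open>(w, y) \<notin> E'\<close> by blast
      \<comment> \<open>The two dags disagree on the edge between w and h: the choice of h gives w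
        \<rightarrow> h in E, while the path from h over y to w forces h \<rightarrow> w in
        \<open>E'\<close>.\<close>
      then have hw': "(h, w) \<in> E'" and wh: "(w, h) \<in> E"
        using acyclic_no_3cycle[OF ac' hy yw] h(2)[OF less.prems] adj[of w h] skeleton_iff[of w h E]
        by blast+
      have "u \<noteq> w" using uh hw' acyclic_no_2cycle[OF ac'] by blast
      have "(u, w) \<in> skeleton E"
        using v[of u w h] \<open>u \<noteq> w\<close> wh u(1) CE hw' acyclic_no_2cycle[OF ac'] by blast
      then have "(u, w) \<in> E'" using adj[of u w] acyclic_no_3cycle[OF ac' uh hw'] by blast
      then have "(y, w) \<in> E" using v[OF uy \<open>u \<noteq> y\<close>, of w] yw by blast
      then show False using wyE acyclic_no_2cycle[OF ac] by blast
    next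
      assume "\<exists>z. (z, y) \<in> C \<and> z \<noteq> h \<and> (z, h) \<notin> skeleton E"
      then obtain z where z: "(z, y) \<in> C" "z \<noteq> h" "(z, h) \<notin> skeleton E" by blast
      have zyE: "(z, y) \<in> E" using z CE by blast
      have zy: "(z, y) \<in> E'" and hy: "(h, y) \<in> E'" using v[OF z(3,2), of y] zyE hyE by auto
      have ne: "w \<noteq> h" "w \<noteq> z" using zy hy \<open>(w, y) \<notin> E'\<close> by auto
      have "(w, h) \<in> skeleton E" "(w, z) \<in> skeleton E"
        using v[of w h y] v[of w z y] ne hyE zyE wyE \<open>(w, y) \<notin> E'\<close> by blast+
      then have "(h, w) \<in> E'" "(z, w) \<in> E'"
        using adj[of w h] adj[of w z] acyclic_no_3cycle[OF ac' hy yw] acyclic_no_3cycle[OF ac' zy yw]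
        by blast+
      then have "(h, w) \<in> E" using v[OF z(3,2), of w] by blast
      then show False using h(2)[OF less.prems] by blast
    qed
  qed
qed

text \<open>An edge a \<rightarrow> y outside C excludes the first case of \<open>labelled\<close>,
  so y has the compelled parents of its highest parent x. If a is not x, then a \<rightarrow> x is
  again an edge outside C, and the induction continues there.\<close>

lemma labelled_compelled_iff:
  assumes lab: "labelled E C" and wf: "wf E"
  shows "(a, y) \<in> E - C \<Longrightarrow> (w, a) \<in> C \<longleftrightarrow> (w, y) \<in> C"
  using wf
proof (induction y arbitrary: a)
  case (less y)
  then have "(a, y) \<in> E" by blast
  with lab show ?case
  proof (cases rule: labelledE)
    case (all x)
    then show ?thesis using less.prems by blast
  next
    case (inherit x)
    show ?thesis
    proof (cases "a = x")
      case False
      then have "(a, x) \<in> E - C" using less.prems inherit by blast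
      from less.IH[OF inherit(1) this] show ?thesis using inherit(3) by blast
    qed (use inherit(3) in blast)
  qed
qed

text \<open>The reversible parents of y other than its highest parent x are also reversible parents
  of x, which reduces the claim for y to edges into x and to the claim for x.\<close>

lemma labelled_clique:
  assumes lab: "labelled E C" and wf: "wf E"
  shows "(a, y) \<in> E - C \<Longrightarrow> (b, y) \<in> E - C \<Longrightarrow> a \<noteq> b \<Longrightarrow> (a, b) \<in> skeleton (E - C)"
  using wf
proof (induction y arbitrary: a b)
  case (less y)
  then have "(a, y) \<in> E" by blast
  with lab show ?case
  proof (cases rule: labelledE)
    case (all x)
    then show ?thesis using less.prems by blast
  next
    case (inherit x)
    have "(c, x) \<in> E - C" if "(c, y) \<in> E - C" "c \<noteq> x" for c
      using that inherit by blast
    then show ?thesis using less.prems less.IH[OF inherit(1)] unfolding skeleton_iff by metis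
  qed
qed

section \<open>Perfect elimination orders and the reorientation of reversible edges\<close>

text \<open>The lists below are read from right to left: an edge points from a later to an earlier entry.\<close>

fun perfect :: "('a \<times> 'a) set \<Rightarrow> 'a list \<Rightarrow> bool" where
  "perfect S [] \<longleftrightarrow> True"
| "perfect S (v # xs) \<longleftrightarrow> perfect S xs \<and>
     (\<forall>a\<in>set xs. \<forall>b\<in>set xs. (a, v) \<in> S \<and> (b, v) \<in> S \<and> a \<noteq> b \<longrightarrow> (a, b) \<in> S)"

fun orient :: "('a \<times> 'a) set \<Rightarrow> 'a list \<Rightarrow> ('a \<times> 'a) set" where
  "orient S [] = {}"
| "orient S (v # xs) = {(a, v) |a. a \<in> set xs \<and> (a, v) \<in> S} \<union> orient S xs"

definition clique :: "('a \<times> 'a) set \<Rightarrow> 'a set \<Rightarrow> bool" where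
  "clique S K \<longleftrightarrow> (\<forall>a\<in>K. \<forall>b\<in>K. a \<noteq> b \<longrightarrow> (a, b) \<in> S)"

lemma perfect_clique: "clique S (set xs) \<Longrightarrow> perfect S xs"
  by (induction xs) (auto simp: clique_def)

text \<open>The condition at an entry of \<open>rest\<close> concerns only its neighbours behind it,
  and by the last assumption the new suffix adds none.\<close>

lemma perfect_replace_suffix:
  assumes "perfect S (rest @ ns)" "perfect S ns'"
    and "\<And>a b. a \<in> set rest \<Longrightarrow> b \<in> set ns' \<Longrightarrow> (b, a) \<in> S \<Longrightarrow> b \<in> set ns"
  shows "perfect S (rest @ ns')"
  using assms
proof (induction rest)
  case (Cons v rest)
  have "perfect S (rest @ ns')" using Cons.prems by (intro Cons.IH) auto
  moreover have "c \<in> set rest \<union> set ns" if "c \<in> set rest \<union> set ns'" "(c, v) \<in> S" for c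
    using that Cons.prems(3)[of v c] by auto
  ultimately show ?case using Cons.prems(1) by simp
qed simp

text \<open>If the first entry v lies in K, then K consists of v and some of its neighbours N, and N
  is a clique. The induction moves N to the end, where N and v are rearranged with K last: any
  arrangement of a clique is perfect, and no entry of \<open>rest\<close> is adjacent to v.\<close>

lemma perfect_reorder:
  assumes "perfect S xs" "distinct xs" "sym S" "K \<subseteq> set xs" "clique S K"
  shows "\<exists>rest ks. perfect S (rest @ ks) \<and> distinct (rest @ ks) \<and> set (rest @ ks) = set xs \<and> set ks = K"
  using assms
proof (induction xs arbitrary: K)
  case Nil
  then show ?case by (auto intro: exI[of _ "[]"])
next
  case (Cons v xs)
  show ?case
  proof (cases "v \<in> K")
    case False
    then have "K \<subseteq> set xs" using Cons.prems by auto
    with Cons.prems obtain rest ks where *: "perfect S (rest @ ks)" "distinct (rest @ ks)"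
      "set (rest @ ks) = set xs" "set ks = K"
      using Cons.IH[of K] unfolding perfect.simps distinct.simps by blast
    have "perfect S ((v # rest) @ ks)" using * Cons.prems(1) by auto
    moreover have "distinct ((v # rest) @ ks)" "set ((v # rest) @ ks) = set (v # xs)"
      using * Cons.prems(2) by auto
    ultimately show ?thesis using *(4) by blast
  next
    case True
    define N where "N = {a \<in> set xs. (a, v) \<in> S}"
    have N: "clique S N" "N \<subseteq> set xs" using Cons.prems(1) by (auto simp: N_def clique_def)
    with Cons.prems obtain rest ns where *: "perfect S (rest @ ns)" "distinct (rest @ ns)"
      "set (rest @ ns) = set xs" "set ns = N"
      using Cons.IH[of N] unfolding perfect.simps distinct.simps by blast
    have KN: "K \<subseteq> insert v N" using Cons.prems(4,5) True by (auto simp: N_def clique_def)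
    have fin: "finite K" "finite (insert v N - K)"
      using KN by (auto simp: N_def intro: finite_subset)
    obtain ks where ks: "set ks = K" "distinct ks" using finite_distinct_list[OF fin(1)] by blast
    obtain ms where ms: "set ms = insert v N - K" "distinct ms"
      using finite_distinct_list[OF fin(2)] by blast
    have set: "set (ms @ ks) = insert v N" using ms ks KN by auto
    have "clique S (insert v N)" using N \<open>sym S\<close> by (auto simp: N_def clique_def dest: symD)
    then have p: "perfect S (ms @ ks)" using set perfect_clique by metis
    have "b \<in> set ns" if "a \<in> set rest" "b \<in> set (ms @ ks)" "(b, a) \<in> S" for a b
    proof -
      have "a \<in> set xs" "a \<notin> N" using that(1) *(2-4) by auto
      then have "b \<noteq> v" using symD[OF \<open>sym S\<close> that(3)] by (auto simp: N_def)
      then show ?thesis using that(2) *(4) unfolding set by blast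
    qed
    from perfect_replace_suffix[OF *(1) p this] have "perfect S ((rest @ ms) @ ks)" by simp
    moreover have "distinct ((rest @ ms) @ ks)"
      using * ks ms set Cons.prems(2) by auto
    moreover have "set ((rest @ ms) @ ks) = set (v # xs)"
      using * set N(2) by auto
    ultimately show ?thesis using ks(1) by blast
  qed
qed

lemma orient_subset: "orient S xs \<subseteq> S \<inter> set xs \<times> set xs"
  by (induction xs) auto

lemma skeleton_orient:
  "sym S \<Longrightarrow> distinct xs \<Longrightarrow> irrefl S \<Longrightarrow> skeleton (orient S xs) = S \<inter> set xs \<times> set xs"
proof (induction xs)
  case Nil
  then show ?case by (simp add: skeleton_def)
next
  case (Cons v xs)
  have 1: "skeleton (orient S (v # xs)) =
    {(a, v) |a. a \<in> set xs \<and> (a, v) \<in> S} \<union> {(v, a) |a. a \<in> set xs \<and> (a, v) \<in> S} \<union>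
    skeleton (orient S xs)"
    by (auto simp: skeleton_def)
  have 2: "skeleton (orient S xs) = S \<inter> set xs \<times> set xs" using Cons by simp
  have 3: "(v, v) \<notin> S" "\<And>a. (a, v) \<in> S \<Longrightarrow> (v, a) \<in> S" "\<And>a. (v, a) \<in> S \<Longrightarrow> (a, v) \<in> S"
    using Cons.prems(1,3) by (auto simp: irrefl_def sym_def)
  show ?case unfolding 1 2
  proof
    show "S \<inter> set (v # xs) \<times> set (v # xs) \<subseteq> {(a, v) |a. a \<in> set xs \<and> (a, v) \<in> S} \<union>
      {(v, a) |a. a \<in> set xs \<and> (a, v) \<in> S} \<union> S \<inter> set xs \<times> set xs"
      using 3(1,3) by auto
  qed (use 3(2) in auto)
qed

lemma orient_increasing:
  "distinct xs \<Longrightarrow> \<exists>f :: 'a \<Rightarrow> nat. \<forall>a b. (a, b) \<in> orient S xs \<longrightarrow> f a < f b"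
proof (induction xs)
  case (Cons v xs)
  then obtain f :: "'a \<Rightarrow> nat" where f: "\<forall>a b. (a, b) \<in> orient S xs \<longrightarrow> f a < f b" by auto
  \<comment> \<open>Edges at v only enter it, so its value has to exceed the others; a sum of
    naturals bounds each summand.\<close>
  let ?g = "f(v := Suc (sum f (set xs)))"
  have "f a < Suc (sum f (set xs))" if "a \<in> set xs" for a
    using that by (simp add: less_Suc_eq_le member_le_sum)
  then have "\<forall>a b. (a, b) \<in> orient S (v # xs) \<longrightarrow> ?g a < ?g b"
    using f orient_subset[of S xs] Cons.prems by fastforce
  then show ?case by blast
qed simp

lemma acyclic_orient:
  assumes "distinct xs"
  shows "acyclic (orient S xs)"
proof -
  obtain f :: "'a \<Rightarrow> nat" where "\<forall>a b. (a, b) \<in> orient S xs \<longrightarrow> f a < f b"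
    using orient_increasing[OF assms] by blast
  then have "orient S xs \<subseteq> inv_image less_than f" by auto
  then show ?thesis by (meson acyclic_subset wf_acyclic wf_inv_image wf_less_than)
qed

text \<open>Both parents of y are neighbours of y that stand behind it in the list. Hence the
  orientation creates no v-structure.\<close>

lemma perfect_orient_clique:
  assumes "perfect S xs" "distinct xs" "(a, y) \<in> orient S xs" "(b, y) \<in> orient S xs" "a \<noteq> b"
  shows "(a, b) \<in> S"
  using assms
proof (induction xs)
  case (Cons v xs)
  then show ?case using orient_subset[of S xs] by (cases "y = v") auto
qed simp

lemma orient_last: "distinct (rest @ [b]) \<Longrightarrow> (a, b) \<notin> orient S (rest @ [b])"
  by (induction rest) auto

text \<open>The new dag is \<open>C \<union> T\<close>, where T directs the reversible edges along a
  perfect elimination order whose list ends with b, so that all reversible edges at b leave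
  b.\<close>

lemma reorient:
  assumes lab: "labelled E C" and wf: "wf E" and ac: "acyclic E" and EU: "E \<subseteq> U \<times> U"
    and ts: "distinct ts" "set ts = U" "perfect (skeleton (E - C)) ts" and ab: "(a, b) \<in> E - C"
  shows "\<exists>E'. E' \<subseteq> U \<times> U \<and> acyclic E' \<and> skeleton E = skeleton E' \<and>
    v_structures E = v_structures E' \<and> (a, b) \<notin> E'"
proof -
  define S where "S = skeleton (E - C)"
  have CE: "C \<subseteq> E" using lab by (simp add: labelled_def)
  have S: "sym S" "irrefl S" "S \<subseteq> U \<times> U"
    using acyclic_no_loop[OF ac] EU by (auto simp: S_def skeleton_def sym_def irrefl_def)
  have b: "{b} \<subseteq> set ts" "clique S {b}" using ab EU ts by (auto simp: clique_def)
  obtain rest ks where p: "perfect S (rest @ ks)" "distinct (rest @ ks)"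
    "set (rest @ ks) = set ts" "set ks = {b}"
    using perfect_reorder[OF _ ts(1) S(1) b] ts(3) by (auto simp: S_def)
  have ks: "ks = [b]" using p(2,4)
    by (metis distinct_append distinct_length_2_or_more distinct_singleton empty_set
        insert_not_empty list.set_cases list.set_intros(1) list.set_intros(2) neq_Nil_conv singletonD)
  define T where "T = orient S (rest @ ks)"
  have T: "skeleton T = S" "acyclic T" "T \<subseteq> S"
    using skeleton_orient[OF S(1) p(2) S(2)] p(3) ts(2) S(3) acyclic_orient[OF p(2)]
      orient_subset[of S "rest @ ks"] by (auto simp: T_def)
  have CS: "(w, c) \<in> C" if "(w, d) \<in> C" "(d, c) \<in> S" for w c d
    using that labelled_compelled_iff[OF lab wf] unfolding S_def skeleton_iff by blast
  have abT: "(a, b) \<notin> C \<union> T"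
    using ab orient_last[of rest b a S] p(2) by (auto simp: T_def ks)
  \<comment> \<open>A compelled path to v followed by v \<rightarrow> w in T can be ended at w
    directly, since v and w have the same compelled parents.\<close>
  have CT: "(m, w) \<in> C\<^sup>+" if "(m, v) \<in> C\<^sup>+" "(v, w) \<in> T" for m v w
    using that(1)
  proof (cases rule: tranclE)
    case base
    then show ?thesis using that(2) T(3) CS by blast
  next
    case (step c)
    then show ?thesis using that(2) T(3) CS by (meson subsetD trancl.simps)
  qed
  \<comment> \<open>Hence every path contracts to one with the same ends that uses T first and C
    afterwards.\<close>
  have trans: "(u, v) \<in> T\<^sup>+ \<or> (\<exists>m. (u, m) \<in> T\<^sup>* \<and> (m, v) \<in> C\<^sup>+)" if "(u, v) \<in> (C \<union> T)\<^sup>+" for u v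
    using that
  proof (induction)
    case (base v)
    then show ?case by blast
  next
    case (step v w)
    then show ?case by (meson CT Un_iff trancl.simps trancl_into_rtrancl)
  qed
  have "(u, u) \<notin> (C \<union> T)\<^sup>+" for u
  proof
    assume "(u, u) \<in> (C \<union> T)\<^sup>+"
    with trans T(2) obtain m where m: "(u, m) \<in> T\<^sup>*" "(m, u) \<in> C\<^sup>+" by (meson acyclic_def)
    \<comment> \<open>Following the T-path from u to m turns the C-path from m to u into a C-cycle
      at m.\<close>
    have "(m, k) \<in> C\<^sup>+" if "(u, k) \<in> T\<^sup>*" for k
      using that by (induction rule: rtrancl_induct) (auto intro: m(2) CT)
    from this[OF m(1)] show False using ac CE by (meson acyclic_def acyclic_subset)
  qed
  then have ac': "acyclic (C \<union> T)" by (simp add: acyclic_def)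
  have sk: "skeleton E = skeleton (C \<union> T)"
    using CE T(1) unfolding S_def skeleton_def by blast
  \<comment> \<open>In both dags the edges of a v-structure are compelled: two reversible edges into
    y have adjacent sources, and by \<open>CS\<close> so have a compelled and a reversible
    one.\<close>
  have "(x, y) \<in> C \<and> (z, y) \<in> C"
    if "(x, y) \<in> E" "(z, y) \<in> E" "x \<noteq> z" "(x, z) \<notin> skeleton E" for x y z
  proof -
    have "\<not> ((x, y) \<notin> C \<and> (z, y) \<notin> C)"
      using labelled_clique[OF lab wf, of x y z] that by (auto simp: skeleton_iff)
    moreover have "(x, y) \<in> C \<longleftrightarrow> (z, y) \<in> C"
      using CS[of x y z] CS[of z y x] that CE unfolding S_def skeleton_iff by blast
    ultimately show ?thesis by blast
  qed
  moreover have "(x, y) \<in> C \<and> (z, y) \<in> C"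
    if "(x, y) \<in> C \<union> T" "(z, y) \<in> C \<union> T" "x \<noteq> z" "(x, z) \<notin> skeleton E" for x y z
  proof -
    have "S \<subseteq> skeleton E" by (auto simp: S_def skeleton_def)
    then have "\<not> ((x, y) \<in> T \<and> (z, y) \<in> T)"
      using perfect_orient_clique[OF p(1,2), of x y z] that by (auto simp: T_def)
    moreover have "(x, y) \<in> C \<longleftrightarrow> (z, y) \<in> C"
      using CS[of x y z] CS[of z y x] that CE T(3) \<open>sym S\<close> unfolding skeleton_iff
      by (meson UnE subsetD symD)
    ultimately show ?thesis using that by blast
  qed
  ultimately have "v_structures E = v_structures (C \<union> T)"
    using CE unfolding v_structures_def sk[symmetric] by blast
  moreover have "C \<union> T \<subseteq> U \<times> U" using CE EU T(3) S(3) by blast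
  ultimately show ?thesis using ac' sk abT by blast
qed

section \<open>Markov equivalent dags represent the same distributions\<close>

text \<open>Here \<open>b'\<close> is the second marginal of the joint distribution p of the pair,
  and \<open>a'\<close> the conditional distribution of the first component given the second. The
  bounds on the supports keep the reversed tables within the admissible states.\<close>

lemma bayes_reversal:
  fixes a :: "'x pmf" and b :: "'x \<Rightarrow> 'y pmf"
  shows "\<exists>b' a'. (\<forall>i j. pmf a i * pmf (b i) j = pmf b' j * pmf (a' j) i) \<and>
    set_pmf b' \<subseteq> (\<Union>i\<in>set_pmf a. set_pmf (b i)) \<and> (\<forall>j. set_pmf (a' j) \<subseteq> set_pmf a)"
proof -
  define p where "p = bind_pmf a (\<lambda>i. map_pmf (Pair i) (b i))"
  \<comment> \<open>Where j has probability 0 there is nothing to condition on; the default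
    \<open>a\<close> respects the bound on the support, and both products vanish.\<close>
  define a' where "a' j = (if j \<in> snd ` set_pmf p then map_pmf fst (cond_pmf p (snd -` {j})) else a)" for j
  have map: "pmf (map_pmf (Pair k) (b k)) (i, j) = (if k = i then pmf (b i) j else 0)" for k i j
    by (auto simp: pmf_map_inj' inj_on_def intro!: pmf_map_outside)
  have p: "pmf p (i, j) = pmf a i * pmf (b i) j" for i j
    unfolding p_def pmf_bind map
    by (subst integral_measure_pmf[of "{i}"]) (auto split: if_splits)
  have "pmf a i * pmf (b i) j = pmf (map_pmf snd p) j * pmf (a' j) i" for i j
  proof (cases "j \<in> snd ` set_pmf p")
    case True
    then have ne: "set_pmf p \<inter> snd -` {j} \<noteq> {}" by auto
    \<comment> \<open>With the second component fixed to j, \<open>fst\<close> is injective on the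
      support.\<close>
    have "pmf (map_pmf fst (cond_pmf p (snd -` {j}))) i = pmf (cond_pmf p (snd -` {j})) (i, j)"
    proof (cases "(i, j) \<in> set_pmf p")
      case True
      then show ?thesis using pmf_map_inj[of fst "cond_pmf p (snd -` {j})" "(i, j)"] ne
        by (force simp: inj_on_def)
    next
      case False
      then have "i \<notin> fst ` set_pmf (cond_pmf p (snd -` {j}))" using ne by auto
      then show ?thesis using False ne by (simp add: pmf_map_outside pmf_cond pmf_eq_0_set_pmf)
    qed
    moreover have "measure_pmf.prob p (snd -` {j}) \<noteq> 0"
      using ne by (simp add: measure_measure_pmf_not_zero)
    ultimately show ?thesis using True ne by (simp add: a'_def pmf_cond pmf_map p[symmetric])
  next
    case False
    then have "(i, j) \<notin> set_pmf p" by force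
    then have "pmf p (i, j) = 0" by (simp add: pmf_eq_0_set_pmf)
    moreover have "pmf (map_pmf snd p) j = 0" using False by (simp add: pmf_map_outside)
    ultimately show ?thesis using p by simp
  qed
  moreover have "set_pmf (map_pmf snd p) \<subseteq> (\<Union>i\<in>set_pmf a. set_pmf (b i))"
    by (auto simp: p_def)
  moreover have "set_pmf (a' j) \<subseteq> set_pmf a" for j
  proof (cases "j \<in> snd ` set_pmf p")
    case True
    then have "set_pmf p \<inter> snd -` {j} \<noteq> {}" by auto
    then have "set_pmf (a' j) \<subseteq> fst ` set_pmf p" using True by (auto simp: a'_def)
    then show ?thesis by (auto simp: p_def)
  qed (simp add: a'_def)
  ultimately show ?thesis by blast
qed

text \<open>One half of \<open>dag_equiv\<close>, so that a reversal has to be examined in one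
  direction only.\<close>

definition representable :: "'a set \<Rightarrow> ('a \<Rightarrow> nat) \<Rightarrow> ('a \<times> 'a) set \<Rightarrow> ('a \<times> 'a) set \<Rightarrow> bool" where
  "representable U r E E' \<longleftrightarrow> (\<forall>t. bayes_net U r E t \<longrightarrow>
     (\<exists>t'. bayes_net U r E' t' \<and> (\<forall>s\<in>configs r U. joint U E t s = joint U E' t' s)))"

lemma dag_equiv_iff_representable:
  "dag_equiv U r E E' \<longleftrightarrow>
     dag U E \<and> dag U E' \<and> representable U r E E' \<and> representable U r E' E"
  unfolding dag_equiv_def representable_def
  by (simp only: eq_commute[of "joint U E' t s" "joint U E t' s" for t t' s])

lemma representable_trans:
  "representable U r E E' \<Longrightarrow> representable U r E' E'' \<Longrightarrow> representable U r E E''"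
  unfolding representable_def by (metis (no_types, lifting))

lemma dag_equiv_refl: "dag U E \<Longrightarrow> dag_equiv U r E E"
  by (auto simp: dag_equiv_iff_representable representable_def)

lemma dag_equiv_trans: "dag_equiv U r E E' \<Longrightarrow> dag_equiv U r E' E'' \<Longrightarrow> dag_equiv U r E E''"
  unfolding dag_equiv_iff_representable by (blast intro: representable_trans)

lemma dag_equiv_sym: "dag_equiv U r E E' \<Longrightarrow> dag_equiv U r E' E"
  unfolding dag_equiv_iff_representable by blast

lemma mem_parents [simp]: "x \<in> parents E y \<longleftrightarrow> (x, y) \<in> E"
  by (simp add: parents_def)

section \<open>Reversal of a covered edge\<close>

definition covered :: "('a \<times> 'a) set \<Rightarrow> 'a \<Rightarrow> 'a \<Rightarrow> bool" where
  "covered E x y \<longleftrightarrow> (x, y) \<in> E \<and> parents E y = insert x (parents E x)"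

definition flip :: "('a \<times> 'a) set \<Rightarrow> 'a \<Rightarrow> 'a \<Rightarrow> ('a \<times> 'a) set" where
  "flip E x y = insert (y, x) (E - {(x, y)})"

context
  fixes E :: "('a \<times> 'a) set" and x y :: 'a
  assumes cov: "covered E x y" and ac: "acyclic E"
begin

lemma covered_neq: "x \<noteq> y"
  using cov ac acyclic_no_loop by (force simp: covered_def)

lemma parents_flip:
  "parents (flip E x y) v =
    (if v = y then parents E x else if v = x then insert y (parents E x) else parents E v)"
  using cov covered_neq acyclic_no_loop[OF ac] unfolding covered_def flip_def
  by (auto simp: set_eq_iff)

lemma covered_flip: "covered (flip E x y) y x"
  unfolding covered_def parents_flip using covered_neq by (simp add: flip_def)

lemma flip_flip: "flip (flip E x y) y x = E"
  using cov acyclic_no_2cycle[OF ac] covered_neq by (auto simp: flip_def covered_def)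

text \<open>A cycle would need a second path from x to y in E. Its last edge starts at a parent of y
  other than x, hence at a parent of x, which closes a cycle in E already.\<close>

lemma acyclic_flip: "acyclic (flip E x y)"
proof -
  let ?F = "E - {(x, y)}"
  have "(x, y) \<notin> ?F\<^sup>*"
  proof
    assume "(x, y) \<in> ?F\<^sup>*"
    then obtain u where u: "(x, u) \<in> ?F\<^sup>*" "(u, y) \<in> ?F"
      using covered_neq by (metis rtranclE)
    then have "(u, x) \<in> E" using cov unfolding covered_def set_eq_iff by auto
    moreover have "(x, u) \<in> E\<^sup>*" using u(1) rtrancl_mono[of ?F E] by blast
    ultimately show False using ac by (meson acyclic_def rtrancl_into_trancl1)
  qed
  then show ?thesis unfolding flip_def using ac by (auto intro: acyclic_subset)
qed

lemma skeleton_flip: "skeleton (flip E x y) = skeleton E"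
  using cov by (auto simp: flip_def skeleton_def covered_def)

text \<open>Parents change only at x and y, which have all other parents in common. The additional
  parent, x of y before and y of x afterwards, is adjacent to all of these and so takes part in no
  v-structure there.\<close>

lemma v_structures_flip: "v_structures (flip E x y) = v_structures E"
proof -
  have 1: "(a, v) \<in> flip E x y \<longleftrightarrow>
    (if v = y then (a, x) \<in> E else if v = x then a = y \<or> (a, x) \<in> E else (a, v) \<in> E)" for a v
    using parents_flip[of v] by (auto simp: set_eq_iff)
  have 2: "(a, y) \<in> E \<longleftrightarrow> a = x \<or> (a, x) \<in> E" for a
    using cov by (auto simp: covered_def set_eq_iff)
  have "(a, v, c) \<in> v_structures (flip E x y) \<longleftrightarrow> (a, v, c) \<in> v_structures E" for a v c
    unfolding v_structures_iff skeleton_flip 1 using 2 covered_neq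
    by (cases "v = x"; cases "v = y") (auto simp: skeleton_iff)
  then show ?thesis by auto
qed

text \<open>For each configuration c of the common parents, \<open>bayes_reversal\<close> rewrites
  the product of the factors of x and y; all other factors stay the same.\<close>

lemma representable_flip:
  assumes fin: "finite U" and EU: "E \<subseteq> U \<times> U"
  shows "representable U r E (flip E x y)"
  unfolding representable_def
proof (intro allI impI)
  fix t assume t: "bayes_net U r E t"
  let ?Z = "parents E x"
  have xy: "x \<in> U" "y \<in> U" using cov EU by (auto simp: covered_def)
  have py: "parents E y = insert x ?Z" using cov by (simp add: covered_def)
  have nZ: "x \<notin> ?Z" "y \<notin> ?Z"
    using acyclic_no_loop[OF ac] acyclic_no_2cycle[OF ac] cov by (auto simp: covered_def)
  obtain B A where AB: "\<And>c i j. pmf (t x c) i * pmf (t y (c(x := i))) j = pmf (B c) j * pmf (A c j) i"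
    "\<And>c. set_pmf (B c) \<subseteq> (\<Union>i\<in>set_pmf (t x c). set_pmf (t y (c(x := i))))"
    "\<And>c j. set_pmf (A c j) \<subseteq> set_pmf (t x c)"
    using bayes_reversal[of "t x c" "\<lambda>i. t y (c(x := i))" for c] by metis
  define t' where
    "t' v c = (if v = y then B c else if v = x then A (restrict c ?Z) (c y) else t v c)" for v c
  have tx: "set_pmf (t x c) \<subseteq> {..<r x}" if "c \<in> configs r ?Z" for c
    using t that xy by (auto simp: bayes_net_def)
  have ty: "set_pmf (t y (c(x := i))) \<subseteq> {..<r y}" if "c \<in> configs r ?Z" "i < r x" for c i
  proof -
    have "c(x := i) \<in> configs r (parents E y)"
      unfolding py using that by (auto simp: configs_def PiE_iff extensional_def)
    then show ?thesis using t xy by (auto simp: bayes_net_def)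
  qed
  have "bayes_net U r (flip E x y) t'"
    unfolding bayes_net_def
  proof (intro conjI ballI)
    show "dag U (flip E x y)"
      using EU xy acyclic_flip by (auto simp: dag_def flip_def)
    fix v c assume v: "v \<in> U" and c: "c \<in> configs r (parents (flip E x y) v)"
    show "set_pmf (t' v c) \<subseteq> {..<r v}"
    proof (cases "v = y")
      case True
      then have "c \<in> configs r ?Z" using c by (simp add: parents_flip)
      then show ?thesis using AB(2)[of c] tx ty True by (fastforce simp: t'_def)
    next
      case neq: False
      show ?thesis
      proof (cases "v = x")
        case True
        then have "restrict c ?Z \<in> configs r ?Z"
          using c neq by (auto simp: parents_flip configs_def PiE_iff)
        then show ?thesis using AB(3) tx True neq by (fastforce simp: t'_def)
      next
        case False
        then show ?thesis using c neq t v by (auto simp: parents_flip t'_def bayes_net_def)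
      qed
    qed
  qed
  moreover have "joint U E t s = joint U (flip E x y) t' s" for s
  proof -
    have *: "prod f U = f x * f y * prod f (U - {x} - {y})" for f :: "'a \<Rightarrow> real"
      using xy fin covered_neq by (simp add: prod.remove mult.assoc)
    have "restrict s (insert x ?Z) = (restrict s ?Z)(x := s x)" by (auto simp: fun_eq_iff)
    then have "pmf (t x (restrict s ?Z)) (s x) * pmf (t y (restrict s (parents E y))) (s y) =
      pmf (B (restrict s ?Z)) (s y) * pmf (A (restrict s ?Z) (s y)) (s x)"
      using AB(1)[of "restrict s ?Z"] by (simp add: py)
    moreover have "restrict (restrict s (insert y ?Z)) ?Z = restrict s ?Z" by (auto simp: fun_eq_iff)
    ultimately show ?thesis
      unfolding joint_def * using covered_neq
      by (simp add: parents_flip t'_def)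
  qed
  ultimately show "\<exists>t'. bayes_net U r (flip E x y) t' \<and>
    (\<forall>s\<in>configs r U. joint U E t s = joint U (flip E x y) t' s)" by blast
qed

end

lemma dag_equiv_flip:
  assumes "covered E x y" "dag U E" "finite U"
  shows "dag_equiv U r E (flip E x y)"
proof -
  have ac: "acyclic E" and EU: "E \<subseteq> U \<times> U" using assms(2) by (auto simp: dag_def)
  have EU': "flip E x y \<subseteq> U \<times> U" using EU assms(1) by (auto simp: flip_def covered_def)
  note ac' = acyclic_flip[OF assms(1) ac]
  have "representable U r (flip E x y) E"
    using representable_flip[OF covered_flip[OF assms(1) ac] ac' assms(3) EU'] flip_flip[OF assms(1) ac]
    by simp
  then show ?thesis unfolding dag_equiv_iff_representable
    using representable_flip[OF assms(1) ac assms(3) EU] assms(2) EU' ac' by (auto simp: dag_def)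
qed

section \<open>Linking Markov equivalent dags by covered reversals\<close>

text \<open>For minimal y, the edges of E into parents of y lie in \<open>E'\<close>. A parent z of
  x not adjacent to y would yield z \<rightarrow> x \<leftarrow> y in \<open>E'\<close> only, and a
  parent of y not adjacent to x a v-structure at y in E only. For an edge x \<rightarrow> z to a
  parent z of y, acyclicity of \<open>E'\<close> would make z \<rightarrow> y differ as well,
  against the maximality of x.\<close>

lemma covered_differing_edge:
  assumes wf: "wf E" "wf (E\<inverse>)" and ac: "acyclic E" and ac': "acyclic E'"
    and sk: "skeleton E = skeleton E'" and vs: "v_structures E = v_structures E'"
    and ne: "E - E' \<noteq> {}"
  shows "\<exists>x y. (x, y) \<in> E - E' \<and> covered E x y"
proof -
  let ?Y = "{y. \<exists>x. (x, y) \<in> E - E'}"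
  have "?Y \<noteq> {}" using ne by auto
  then obtain y where y: "y \<in> ?Y" and "\<And>u. (u, y) \<in> E \<Longrightarrow> u \<notin> ?Y"
    by (rule wfE_min'[OF wf(1)]) (rule that)
  then have below: "\<And>u w. (u, y) \<in> E \<Longrightarrow> (w, u) \<notin> E - E'" by blast
  let ?X = "{x. (x, y) \<in> E - E'}"
  have "?X \<noteq> {}" using y by auto
  then obtain x where "x \<in> ?X" and "\<And>z. (z, x) \<in> E\<inverse> \<Longrightarrow> z \<notin> ?X"
    by (rule wfE_min'[OF wf(2)]) (rule that)
  then have x: "(x, y) \<in> E - E'" and above: "\<And>z. (x, z) \<in> E \<Longrightarrow> (z, y) \<notin> E - E'" by auto
  have edge: "(a, b) \<in> E' \<or> (b, a) \<in> E'" if "(a, b) \<in> E" for a b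
    using that sk by (metis skeleton_iff)
  have v: "(a, b) \<in> E \<and> (c, b) \<in> E \<longleftrightarrow> (a, b) \<in> E' \<and> (c, b) \<in> E'"
    if "(a, c) \<notin> skeleton E" "a \<noteq> c" for a b c
  proof -
    have "(a, b, c) \<in> v_structures E \<longleftrightarrow> (a, b, c) \<in> v_structures E'" by (simp add: vs)
    then show ?thesis using that sk by (simp add: v_structures_iff)
  qed
  have xy: "(x, y) \<in> E" and yx: "(y, x) \<in> E'" using x edge by auto
  have "(z, y) \<in> E" if "(z, x) \<in> E" for z
  proof -
    have "(z, x) \<in> E'" using below[OF xy] that by blast
    moreover have "z \<noteq> y" using that xy acyclic_no_2cycle[OF ac] by blast
    ultimately have "(z, y) \<in> skeleton E"
      using v[of z y x] yx xy acyclic_no_2cycle[OF ac xy] by blast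
    then show ?thesis using acyclic_no_3cycle[OF ac that xy] by (simp add: skeleton_iff)
  qed
  moreover have "(z, x) \<in> E" if "(z, y) \<in> E" "z \<noteq> x" for z
  proof -
    have "(z, x) \<in> skeleton E" using v[of z x y] that xy x by blast
    moreover have "(x, z) \<notin> E"
    proof
      assume xz: "(x, z) \<in> E"
      then have "(x, z) \<in> E'" using below[OF that(1)] by blast
      then have "(z, y) \<notin> E'" using acyclic_no_3cycle[OF ac' yx] by blast
      then show False using above[OF xz] that by blast
    qed
    ultimately show ?thesis by (simp add: skeleton_iff)
  qed
  ultimately have "covered E x y" using xy by (auto simp: covered_def set_eq_iff)
  then show ?thesis using x by blast
qed

theorem markov_equivalent_imp_dag_equiv:
  assumes "finite U" "dag U E" "dag U E'"
    and "skeleton E = skeleton E'" "v_structures E = v_structures E'"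
  shows "dag_equiv U r E E'"
  using assms(2,4,5)
proof (induction "card (E - E')" arbitrary: E rule: less_induct)
  case less
  have ac: "acyclic E" "acyclic E'" and fin: "finite E"
    using less.prems(1) assms(1,3) by (auto simp: dag_def intro: finite_subset)
  have "wf E" "wf (E\<inverse>)"
    using ac fin by (simp_all add: finite_acyclic_wf finite_acyclic_wf_converse)
  show ?case
  proof (cases "E - E' = {}")
    case True
    have "(a, b) \<in> E" if "(a, b) \<in> E'" for a b
    proof -
      have "(a, b) \<in> skeleton E" using that less.prems(2) by (simp add: skeleton_iff)
      then show ?thesis using that True acyclic_no_2cycle[OF ac(2) that] by (auto simp: skeleton_iff)
    qed
    then have "E = E'" using True by auto
    then show ?thesis using assms(3) dag_equiv_refl by blast
  next
    case False
    then obtain x y where xy: "(x, y) \<in> E - E'" and cov: "covered E x y"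
      using covered_differing_edge[OF \<open>wf E\<close> \<open>wf (E\<inverse>)\<close> ac less.prems(2,3)] by blast
    \<comment> \<open>As \<open>E'\<close> contains y \<rightarrow> x, the reversal removes one
      differing edge and adds none.\<close>
    have "(y, x) \<in> E'" using xy less.prems(2) skeleton_iff by (metis DiffD1 DiffD2)
    then have "flip E x y - E' = E - E' - {(x, y)}" by (auto simp: flip_def)
    then have card: "card (flip E x y - E') < card (E - E')"
      using xy fin by (metis card_Diff1_less finite_Diff)
    note equiv = dag_equiv_flip[OF cov less.prems(1) assms(1)]
    then have "dag U (flip E x y)" by (simp add: dag_equiv_def)
    then show ?thesis
      using less.hyps[OF card] less.prems skeleton_flip[OF cov ac(1)] v_structures_flip[OF cov ac(1)]
        dag_equiv_trans[OF equiv] by simp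
  qed
qed

section \<open>Equivalent dags have the same skeleton and v-structures\<close>

text \<open>The omitted factors are probabilities, hence at most 1. This isolates the few nodes
  whose factors matter.\<close>

lemma joint_le_prod:
  assumes "finite U" "A \<subseteq> U"
  shows "joint U E t s \<le> (\<Prod>v\<in>A. pmf (t v (restrict s (parents E v))) (s v))"
proof -
  let ?f = "\<lambda>v. pmf (t v (restrict s (parents E v))) (s v)"
  have "joint U E t s = prod ?f (U - A) * prod ?f A"
    unfolding joint_def using assms by (intro prod.subset_diff)
  also have "\<dots> \<le> 1 * prod ?f A"
    by (intro mult_right_mono prod_le_1 prod_nonneg) (auto simp: pmf_le_1)
  finally show ?thesis by simp
qed

lemma pmf_add_le_1:
  assumes "i \<noteq> j"
  shows "pmf p i + pmf p j \<le> 1"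
proof -
  have "pmf p i + pmf p j = measure_pmf.prob p {i, j}"
    using assms by (simp add: measure_measure_pmf_finite)
  then show ?thesis by simp
qed

text \<open>If A is a single node with value 0 or 1, the parity at y is a copy of it. One
  construction thus serves the test for adjacency and the test for v-structures.\<close>

definition parity_config :: "'a set \<Rightarrow> 'a set \<Rightarrow> 'a \<Rightarrow> ('a \<Rightarrow> nat) \<Rightarrow> 'a \<Rightarrow> nat" where
  "parity_config U A y g =
     (\<lambda>v\<in>U. if v \<in> A then g v else if v = y then (\<Sum>a\<in>A. g a) mod 2 else 0)"

text \<open>The nodes in A are fair coins that ignore their parents, y computes the parity of A, and
  all other nodes are constantly 0. Only the coins contribute factors different from 1.\<close>

lemma parity_net:
  assumes fin: "finite U" and r: "\<And>v. v \<in> U \<Longrightarrow> 2 \<le> r v" and dag: "dag U E"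
    and A: "A \<subseteq> parents E y"
  shows "\<exists>t. bayes_net U r E t \<and>
    (\<forall>g. (\<forall>a\<in>A. g a < 2) \<longrightarrow> joint U E t (parity_config U A y g) = (1 / 2) ^ card A)"
proof -
  define t where "t v c = (if v \<in> A then pmf_of_set {0, 1::nat} else
    if v = y then return_pmf ((\<Sum>a\<in>A. c a) mod 2) else return_pmf 0)" for v :: 'a and c :: "'a \<Rightarrow> nat"
  have AU: "A \<subseteq> U" using A dag unfolding dag_def parents_def by blast
  have "set_pmf (t v c) \<subseteq> {..<2}" for v c
    by (auto simp: t_def)
  then have "bayes_net U r E t"
    unfolding bayes_net_def using dag r by (meson lessThan_subset_iff order_trans)
  moreover have "joint U E t (parity_config U A y g) = (1 / 2) ^ card A" if g: "\<forall>a\<in>A. g a < 2" for g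
  proof -
    let ?s = "parity_config U A y g"
    have s: "?s v = g v" if "v \<in> A" for v using that AU by (auto simp: parity_config_def)
    have "pmf (t v (restrict ?s (parents E v))) (?s v) = (if v \<in> A then 1 / 2 else 1)" if "v \<in> U" for v
    proof (cases "v \<in> A")
      case True
      then have "g v \<in> {0, 1}" using g by (auto simp: less_2_cases_iff)
      then show ?thesis using True s by (auto simp: t_def)
    next
      case False
      have "(\<Sum>a\<in>A. restrict ?s (parents E y) a) = (\<Sum>a\<in>A. g a)"
        using A s by (intro sum.cong) auto
      then show ?thesis using False that by (simp add: t_def parity_config_def)
    qed
    then have "joint U E t ?s = (\<Prod>v\<in>U. if v \<in> A then 1 / 2 else 1)"
      unfolding joint_def by (rule prod.cong[OF refl])
    also have "\<dots> = (\<Prod>v\<in>U \<inter> A. 1 / 2)" by (rule prod.inter_restrict[OF fin, symmetric])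
    finally show ?thesis using AU by (simp add: Int_absorb1)
  qed
  ultimately show ?thesis by blast
qed

lemma parity_config_in_configs:
  assumes "\<And>v. v \<in> U \<Longrightarrow> 2 \<le> r v" "\<forall>a\<in>A. g a < 2"
  shows "parity_config U A y g \<in> configs r U"
proof -
  have "parity_config U A y g v < 2" if "v \<in> U" for v
    using that assms(2) by (simp add: parity_config_def)
  then show ?thesis unfolding configs_def using assms(1)
    by (fastforce simp: PiE_iff parity_config_def extensional_def intro: less_le_trans)
qed

lemma parity_representation:
  assumes "finite U" "\<And>v. v \<in> U \<Longrightarrow> 2 \<le> r v" "dag_equiv U r E E'" "A \<subseteq> parents E y"
  shows "\<exists>t. bayes_net U r E' t \<and>
    (\<forall>g. (\<forall>a\<in>A. g a < 2) \<longrightarrow> joint U E' t (parity_config U A y g) = (1 / 2) ^ card A)"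
proof -
  obtain t where t: "bayes_net U r E t"
    "\<And>g. (\<forall>a\<in>A. g a < 2) \<Longrightarrow> joint U E t (parity_config U A y g) = (1 / 2) ^ card A"
    using parity_net[of U r E A y] assms by (auto simp: dag_equiv_def)
  obtain t' where t': "bayes_net U r E' t'" "\<And>s. s \<in> configs r U \<Longrightarrow> joint U E t s = joint U E' t' s"
    using t(1) assms(3) unfolding dag_equiv_def by blast
  have "joint U E' t' (parity_config U A y g) = (1 / 2) ^ card A" if "\<forall>a\<in>A. g a < 2" for g
    using t(2)[OF that] t'(2)[OF parity_config_in_configs[OF assms(2) that]] by simp
  then show ?thesis using t'(1) by blast
qed

text \<open>If x and y were not adjacent in E', a fair coin x copied to y would be bounded by a product of
  two distributions, which cannot put mass 1/2 on both (0, 0) and (1, 1).\<close>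

lemma dag_equiv_adjacent:
  assumes fin: "finite U" and r: "\<And>v. v \<in> U \<Longrightarrow> 2 \<le> r v" and eq: "dag_equiv U r E E'"
    and xy: "(x, y) \<in> E"
  shows "(x, y) \<in> skeleton E'"
proof (rule ccontr)
  assume "(x, y) \<notin> skeleton E'"
  then have nadj: "(x, y) \<notin> E'" "(y, x) \<notin> E'" by (auto simp: skeleton_iff)
  have ac: "acyclic E" "acyclic E'" and EU: "E \<subseteq> U \<times> U" using eq by (auto simp: dag_equiv_def dag_def)
  have ne: "x \<noteq> y" using xy acyclic_no_loop[OF ac(1)] by blast
  have U: "x \<in> U" "y \<in> U" using xy EU by auto
  obtain t where t: "\<And>g. g x < 2 \<Longrightarrow> joint U E' t (parity_config U {x} y g) = 1 / 2"
    using parity_representation[OF fin r eq, of "{x}" y] xy by auto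
  define s where "s i = parity_config U {x} y (\<lambda>_. i)" for i
  have s: "s i x = i" "i < 2 \<Longrightarrow> s i y = i" "v \<noteq> x \<Longrightarrow> v \<noteq> y \<Longrightarrow> s i v = s 0 v" for i v
    using U ne by (auto simp: s_def parity_config_def)
  have restr: "restrict (s i) (parents E' x) = restrict (s 0) (parents E' x)"
    "restrict (s i) (parents E' y) = restrict (s 0) (parents E' y)" for i
    using nadj acyclic_no_loop[OF ac(2)] s(3) by (auto simp: fun_eq_iff restrict_def) metis+
  define p where "p = t x (restrict (s 0) (parents E' x))"
  define q where "q = t y (restrict (s 0) (parents E' y))"
  have "1 / 2 \<le> pmf p i * pmf q i" if "i < 2" for i
  proof -
    have "1 / 2 \<le> (\<Prod>v\<in>{x, y}. pmf (t v (restrict (s i) (parents E' v))) (s i v))"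
      using joint_le_prod[OF fin, of "{x, y}" E' t "s i"] t[of "\<lambda>_. i"] U that by (simp add: s_def)
    then show ?thesis using ne s(1,2) that by (simp add: restr[of i] p_def q_def)
  qed
  from this[of 0] this[of 1] have *: "1 / 2 \<le> pmf p 0 * pmf q 0" "1 / 2 \<le> pmf p 1 * pmf q 1" by auto
  have le: "pmf p i * pmf q i \<le> pmf p i" "pmf p i * pmf q i \<le> pmf q i" for i
    by (simp_all add: mult_left_le mult_left_le_one_le pmf_le_1)
  \<comment> \<open>Each factor is at least the product, so p and q both give 1 the mass 1/2 or more
    and leave at most 1/2 for 0.\<close>
  have "1 / 2 \<le> pmf p 1" "1 / 2 \<le> pmf q 1"
    using * le[of 1] by linarith+
  then have "pmf p 0 \<le> 1 / 2" "pmf q 0 \<le> 1 / 2"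
    using pmf_add_le_1[of 0 1 p] pmf_add_le_1[of 0 1 q] by auto
  then have "pmf p 0 * pmf q 0 \<le> 1 / 2 * (1 / 2)" by (intro mult_mono) auto
  then show False using * by simp
qed

text \<open>If y is the parity of independent fair coins x and z, the joint distribution of y and z is
  uniform, and x is determined by both but not by y alone.\<close>

lemma dag_equiv_collider:
  assumes fin: "finite U" and r: "\<And>v. v \<in> U \<Longrightarrow> 2 \<le> r v" and eq: "dag_equiv U r E E'"
    and xy: "(x, y) \<in> E" and zy: "(z, y) \<in> E" and "x \<noteq> z"
    and nadj: "(x, z) \<notin> skeleton E'"
  shows "(y, x) \<notin> E'"
proof
  assume yx: "(y, x) \<in> E'"
  have ac: "acyclic E" "acyclic E'" and EU: "E \<subseteq> U \<times> U" using eq by (auto simp: dag_equiv_def dag_def)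
  have ne: "x \<noteq> y" "z \<noteq> y" "x \<noteq> z" using xy zy acyclic_no_loop[OF ac(1)] \<open>x \<noteq> z\<close> by auto
  have U: "x \<in> U" "y \<in> U" "z \<in> U" using xy zy EU by auto
  obtain t where t: "\<And>g. g x < 2 \<Longrightarrow> g z < 2 \<Longrightarrow> joint U E' t (parity_config U {x, z} y g) = 1 / 4"
    using parity_representation[OF fin r eq, of "{x, z}" y] xy zy \<open>x \<noteq> z\<close>
    by (auto simp: power2_eq_square)
  \<comment> \<open>The configurations are indexed by the values j of y and k of z, which determine
    the value of x.\<close>
  define s where "s j k = parity_config U {x, z} y (\<lambda>v. if v = x then (j + k) mod 2 else k)" for j k
  have par: "((j + k) mod 2 + k) mod 2 = j" if "j < 2" for j k :: nat
    using that by presburger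
  have s: "s j k x = (j + k) mod 2" "s j k z = k" "j < 2 \<Longrightarrow> s j k y = j"
    "v \<noteq> x \<Longrightarrow> v \<noteq> y \<Longrightarrow> v \<noteq> z \<Longrightarrow> s j k v = s 0 0 v" for j k v
    using U ne par by (auto simp: s_def parity_config_def)
  have npar: "(x, x) \<notin> E'" "(y, y) \<notin> E'" "(z, z) \<notin> E'" "(x, y) \<notin> E'" "(x, z) \<notin> E'" "(z, x) \<notin> E'"
    using acyclic_no_loop[OF ac(2)] acyclic_no_2cycle[OF ac(2) yx] nadj by (auto simp: skeleton_iff)
  have restr: "restrict (s j k) (parents E' v) = restrict (s j' k') (parents E' v)"
    if "(x, v) \<notin> E'" "(y, v) \<in> E' \<Longrightarrow> s j k y = s j' k' y" "(z, v) \<in> E' \<Longrightarrow> k = k'" for j k j' k' v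
  proof
    fix w
    show "restrict (s j k) (parents E' v) w = restrict (s j' k') (parents E' v) w"
    proof (cases "w = y \<or> w = z")
      case True
      then show ?thesis using that s(2) by (auto simp: restrict_def)
    next
      case False
      then show ?thesis using that(1) s(4)[of w j k] s(4)[of w j' k'] by (cases "w = x") auto
    qed
  qed
  define f where "f v j k = t v (restrict (s j k) (parents E' v))" for v j k
  define h where "h j k = pmf (f z j k) k * pmf (f y j k) j" for j k
  have bound: "1 / 4 \<le> pmf (f x j k) ((j + k) mod 2) * h j k" if "j < 2" "k < 2" for j k
  proof -
    have "1 / 4 \<le> (\<Prod>v\<in>{x, z, y}. pmf (f v j k) (s j k v))"
      using joint_le_prod[OF fin, of "{x, z, y}" E' t "s j k"]
        t[of "\<lambda>v. if v = x then (j + k) mod 2 else k"] U that by (simp add: s_def f_def)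
    then show ?thesis using ne s(1-3) that by (simp add: h_def)
  qed
  \<comment> \<open>Neither y nor z is a child of x, and at least one of them is no child of the
    other. So h collects weights of a two-stage experiment, which draws that one first.\<close>
  have h_sum: "h 0 0 + h 0 1 + h 1 0 + h 1 1 \<le> 1"
  proof -
    have mix: "pmf p 0 * pmf (q 0) 0 + pmf p 0 * pmf (q 0) 1 + pmf p 1 * pmf (q 1) 0 +
      pmf p 1 * pmf (q 1) 1 \<le> 1" for p :: "nat pmf" and q :: "nat \<Rightarrow> nat pmf"
    proof -
      have "pmf p i * (pmf (q i) 0 + pmf (q i) 1) \<le> pmf p i" for i
        using pmf_add_le_1[of 0 1 "q i"] by (simp add: mult_left_le)
      from this[of 0] this[of 1] pmf_add_le_1[of 0 1 p] show ?thesis by (simp add: distrib_left)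
    qed
    show ?thesis
    proof (cases "(y, z) \<in> E'")
      case True
      then have "(z, y) \<notin> E'" using acyclic_no_2cycle[OF ac(2)] by blast
      then have y: "f y j k = f y 0 0" for j k using npar by (auto simp: f_def intro!: arg_cong[of _ _ "t y"] restr)
      have z: "f z j k = f z j 0" if "j < 2" for j k
        using npar s(3)[OF that] by (auto simp: f_def intro!: arg_cong[of _ _ "t z"] restr)
      show ?thesis using mix[of "f y 0 0" "\<lambda>j. f z j 0"] z[of 0 1] z[of 1 1] y[of 0 1] y[of 1 0] y[of 1 1]
        by (simp add: h_def mult.commute)
    next
      case False
      then have z: "f z j k = f z 0 0" for j k using npar by (auto simp: f_def intro!: arg_cong[of _ _ "t z"] restr)
      have y: "f y j k = f y 0 k" for j k
        using npar by (auto simp: f_def intro!: arg_cong[of _ _ "t y"] restr)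
      show ?thesis using mix[of "f z 0 0" "\<lambda>k. f y 0 k"] z[of 0 1] z[of 1 1] z[of 1 0] y[of 1 1] y[of 1 0]
        by (simp add: h_def)
    qed
  qed
  have h0: "0 \<le> h j k" for j k by (simp add: h_def)
  have "1 / 4 \<le> h j k" if "j < 2" "k < 2" for j k
  proof -
    have "pmf (f x j k) ((j + k) mod 2) * h j k \<le> h j k"
      using h0 by (simp add: mult_left_le_one_le pmf_le_1)
    then show ?thesis using bound[OF that] by linarith
  qed
  from this[of 0 0] this[of 0 1] this[of 1 0] this[of 1 1] h_sum
  have h: "h 0 0 = 1 / 4" "h 0 1 = 1 / 4" by auto
  \<comment> \<open>As z is no parent of x, the distribution of x is the same for both values of z,
    yet it would have to put mass 1 on 0 and on 1.\<close>
  have x: "f x 0 1 = f x 0 0"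
    using npar s(3) by (auto simp: f_def intro!: arg_cong[of _ _ "t x"] restr)
  have "1 \<le> pmf (f x 0 0) 0" "1 \<le> pmf (f x 0 0) 1"
    using bound[of 0 0] bound[of 0 1] unfolding x h by auto
  then show False using pmf_add_le_1[of 0 1 "f x 0 0"] by simp
qed

lemma dag_equiv_skeleton:
  assumes "finite U" "\<And>v. v \<in> U \<Longrightarrow> 2 \<le> r v" "dag_equiv U r E E'"
  shows "skeleton E = skeleton E'"
proof -
  have "skeleton E \<subseteq> skeleton E'" if "dag_equiv U r E E'" for E E'
    using dag_equiv_adjacent[OF assms(1,2) that] by (auto simp: skeleton_def)
  then show ?thesis using assms(3) dag_equiv_sym by blast
qed

text \<open>The skeletons agree, and \<open>dag_equiv_collider\<close>, applied to x and to z,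
  excludes that either edge at y is reversed.\<close>

lemma dag_equiv_v_structures:
  assumes fin: "finite U" and r: "\<And>v. v \<in> U \<Longrightarrow> 2 \<le> r v" and "dag_equiv U r E E'"
  shows "v_structures E = v_structures E'"
proof -
  have "(x, y, z) \<in> v_structures E'"
    if eq: "dag_equiv U r E E'" and v: "(x, y, z) \<in> v_structures E" for E E' x y z
  proof -
    note sk = dag_equiv_skeleton[OF fin r eq]
    have *: "(x, y) \<in> E" "(z, y) \<in> E" "x \<noteq> z" "(x, z) \<notin> skeleton E'"
      using v sk by (auto simp: v_structures_iff)
    then have "(z, x) \<notin> skeleton E'" by (simp add: skeleton_iff)
    then have "(y, x) \<notin> E'" "(y, z) \<notin> E'"
      using dag_equiv_collider[OF fin r eq] * by blast+
    moreover have "(x, y) \<in> skeleton E" "(z, y) \<in> skeleton E"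
      using * by (simp_all add: skeleton_iff)
    ultimately show ?thesis using *(3,4) by (simp add: v_structures_iff sk) (simp add: skeleton_iff)
  qed
  then show ?thesis using assms(3) dag_equiv_sym by fast
qed

section \<open>The labelling computed by the algorithm\<close>

lemma hd_filter_least:
  assumes "sorted_wrt (\<lambda>a b. pos a < pos b) xs" "v \<in> set xs" "P v"
  shows "hd (filter P xs) \<in> set xs" "P (hd (filter P xs))" "(pos (hd (filter P xs)) :: nat) \<le> pos v"
proof -
  obtain u us where u: "filter P xs = u # us" using assms(2,3) by (cases "filter P xs") (auto simp: filter_empty_conv)
  have sorted: "sorted_wrt (\<lambda>a b. pos a < pos b) (u # us)" using sorted_wrt_filter[OF assms(1), of P] u by simp
  have set: "w \<in> set (u # us) \<longleftrightarrow> w \<in> set xs \<and> P w" for w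
    unfolding u[symmetric] by auto
  have "v \<in> set (u # us)" "u \<in> set xs \<and> P u" using assms(2,3) set[of v] set[of u] by simp_all
  then show "hd (filter P xs) \<in> set xs" "P (hd (filter P xs))" "pos (hd (filter P xs)) \<le> pos v"
    using sorted by (auto simp: u)
qed

lemma last_filter_greatest:
  assumes "sorted_wrt (\<lambda>a b. pos a < pos b) xs" "v \<in> set xs" "P v"
  shows "last (filter P xs) \<in> set xs" "P (last (filter P xs))" "(pos v :: nat) \<le> pos (last (filter P xs))"
proof -
  obtain u us where u: "filter P xs = us @ [u]"
    using assms(2,3) by (cases "filter P xs" rule: rev_cases) (auto simp: filter_empty_conv)
  have sorted: "sorted_wrt (\<lambda>a b. pos a < pos b) (us @ [u])" using sorted_wrt_filter[OF assms(1), of P] u by simp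
  have set: "w \<in> set (us @ [u]) \<longleftrightarrow> w \<in> set xs \<and> P w" for w
    unfolding u[symmetric] by auto
  have "v \<in> set (us @ [u])" "u \<in> set xs \<and> P u" using assms(2,3) set[of v] set[of u] by simp_all
  then show "last (filter P xs) \<in> set xs" "P (last (filter P xs))" "pos v \<le> pos (last (filter P xs))"
    using sorted by (auto simp: u sorted_wrt_append)
qed

text \<open>The order that \<open>order_edges\<close> realises. Sources are compared in reverse
  because among the edges into one node the highest source is ranked first.\<close>

definition edge_less :: "('a \<Rightarrow> nat) \<Rightarrow> 'a \<times> 'a \<Rightarrow> 'a \<times> 'a \<Rightarrow> bool" where
  "edge_less pos e e' \<longleftrightarrow> pos (snd e) < pos (snd e') \<or>
     pos (snd e) = pos (snd e') \<and> pos (fst e') < pos (fst e)"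

lemma edge_less_asym: "edge_less pos e e' \<Longrightarrow> \<not> edge_less pos e' e"
  by (auto simp: edge_less_def)

lemma edge_less_total:
  assumes "inj_on pos U" "e \<in> U \<times> U" "e' \<in> U \<times> U" "e \<noteq> e'"
  shows "edge_less pos e e' \<or> edge_less pos e' e"
proof -
  have "fst e \<noteq> fst e' \<Longrightarrow> pos (fst e) \<noteq> pos (fst e')"
    "snd e \<noteq> snd e' \<Longrightarrow> pos (snd e) \<noteq> pos (snd e')"
    using assms(1-3) by (auto simp: inj_on_eq_iff mem_Times_iff)
  then show ?thesis
    using assms(4) unfolding edge_less_def prod_eq_iff by (metis linorder_neqE_nat)
qed

lemma order_edges_lexicographic:
  fixes pos :: "'a \<Rightarrow> nat"
  assumes fin: "finite E" and EU: "E \<subseteq> set ts \<times> set ts" and inj: "inj_on pos (set ts)"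
    and sorted: "sorted_wrt (\<lambda>a b. pos a < pos b) ts"
  shows "\<forall>e\<in>E. \<forall>e'\<in>E. edge_less pos e e' \<longrightarrow> the (order_edges E ts e) < the (order_edges E ts e')"
proof -
  define b :: "nat \<times> ('a \<times> 'a \<Rightarrow> nat option) \<Rightarrow> bool" where "b = (\<lambda>(i, rank). \<exists>e\<in>E. rank e = None)"
  define c :: "nat \<times> ('a \<times> 'a \<Rightarrow> nat option) \<Rightarrow> _" where "c = (\<lambda>(i, rank).
        let y = hd (filter (\<lambda>y. \<exists>x. (x, y) \<in> E \<and> rank (x, y) = None) ts);
            x = last (filter (\<lambda>x. (x, y) \<in> E \<and> rank (x, y) = None) ts)
        in (i + 1, rank((x, y) \<mapsto> i)))"
  \<comment> \<open>Invariant: ranked edges precede unranked ones, and the ranks lie below the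
    counter and increase along \<open>edge_less\<close>.\<close>
  define P :: "nat \<times> ('a \<times> 'a \<Rightarrow> nat option) \<Rightarrow> bool" where "P = (\<lambda>(i, rank).
    (\<forall>e n. rank e = Some n \<longrightarrow> e \<in> E \<and> n < i) \<and>
    (\<forall>e\<in>E. \<forall>e'\<in>E. rank e \<noteq> None \<longrightarrow> rank e' = None \<longrightarrow> edge_less pos e e') \<and>
    (\<forall>e e' m n. rank e = Some m \<longrightarrow> rank e' = Some n \<longrightarrow> edge_less pos e e' \<longrightarrow> m < n))"
  have step: "\<exists>e0\<in>E. rank e0 = None \<and> c (i, rank) = (i + 1, rank(e0 \<mapsto> i)) \<and>
      (\<forall>e\<in>E. rank e = None \<longrightarrow> e \<noteq> e0 \<longrightarrow> edge_less pos e0 e)" if "b (i, rank)" for i rank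
  proof -
    define y where "y = hd (filter (\<lambda>y. \<exists>x. (x, y) \<in> E \<and> rank (x, y) = None) ts)"
    define x where "x = last (filter (\<lambda>x. (x, y) \<in> E \<and> rank (x, y) = None) ts)"
    have y_le: "pos y \<le> pos v" "\<exists>u. (u, y) \<in> E \<and> rank (u, y) = None"
      if "(u, v) \<in> E" "rank (u, v) = None" for u v
      using hd_filter_least[OF sorted, of v "\<lambda>y. \<exists>x. (x, y) \<in> E \<and> rank (x, y) = None"] that EU
      by (auto simp: y_def)
    then have "\<exists>u. (u, y) \<in> E \<and> rank (u, y) = None" using that by (auto simp: b_def)
    then have x: "(x, y) \<in> E" "rank (x, y) = None"
      and x_ge: "\<And>u. (u, y) \<in> E \<Longrightarrow> rank (u, y) = None \<Longrightarrow> pos u \<le> pos x"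
      using last_filter_greatest[OF sorted, of _ "\<lambda>x. (x, y) \<in> E \<and> rank (x, y) = None"] EU
      by (auto simp: x_def)
    have "edge_less pos (x, y) e" if e: "e \<in> E" "rank e = None" "e \<noteq> (x, y)" for e
    proof (rule ccontr)
      assume "\<not> edge_less pos (x, y) e"
      then have "edge_less pos e (x, y)"
        using edge_less_total[OF inj, of e "(x, y)"] e x EU by blast
      moreover have "pos y \<le> pos (snd e)" using y_le(1)[of "fst e" "snd e"] e by simp
      ultimately have "pos (snd e) = pos y" "pos x < pos (fst e)" by (auto simp: edge_less_def)
      moreover from this(1) have "snd e = y"
        using inj subsetD[OF EU e(1)] subsetD[OF EU x(1)] by (simp add: inj_on_eq_iff mem_Times_iff)
      then have "pos (fst e) \<le> pos x" using x_ge[of "fst e"] e by auto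
      ultimately show False by simp
    qed
    moreover have "c (i, rank) = (i + 1, rank((x, y) \<mapsto> i))"
      by (simp add: c_def Let_def x_def y_def)
    ultimately show ?thesis using x by blast
  qed
  let ?r = "inv_image less_than (\<lambda>(i, rank). card {e \<in> E. rank e = None})"
  have body: "P (c (i, rank)) \<and> (c (i, rank), (i, rank)) \<in> ?r"
    if P: "P (i, rank)" and b: "b (i, rank)" for i rank
  proof -
    obtain e0 where e0: "e0 \<in> E" "rank e0 = None" "c (i, rank) = (i + 1, rank(e0 \<mapsto> i))"
      "\<And>e. e \<in> E \<Longrightarrow> rank e = None \<Longrightarrow> e \<noteq> e0 \<Longrightarrow> edge_less pos e0 e"
      using step[OF b] by blast
    from P have P1: "\<And>e n. rank e = Some n \<Longrightarrow> e \<in> E \<and> n < i"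
      and P2: "\<And>e e'. e \<in> E \<Longrightarrow> e' \<in> E \<Longrightarrow> rank e \<noteq> None \<Longrightarrow> rank e' = None \<Longrightarrow> edge_less pos e e'"
      and P3: "\<And>e e' m n. rank e = Some m \<Longrightarrow> rank e' = Some n \<Longrightarrow> edge_less pos e e' \<Longrightarrow> m < n"
      by (auto simp: P_def)
    let ?rank = "rank(e0 \<mapsto> i)"
    have "e \<in> E \<and> n < i + 1" if "?rank e = Some n" for e n
      using that P1[of e n] e0(1) by (auto split: if_splits)
    moreover have "edge_less pos e e'" if "e \<in> E" "e' \<in> E" "?rank e \<noteq> None" "?rank e' = None" for e e'
      using that P2[of e e'] e0(4)[of e'] by (auto split: if_splits)
    moreover have "m < n" if "?rank e = Some m" "?rank e' = Some n" "edge_less pos e e'" for e e' m n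
    proof (cases "e = e0")
      case True
      have "\<not> edge_less pos e0 e0" using edge_less_asym by blast
      then have "e' \<noteq> e0" using that True by blast
      then have "edge_less pos e' e0" using that P1[of e' n] P2[of e' e0] e0 by auto
      then show ?thesis using that True edge_less_asym by blast
    next
      case False
      then show ?thesis using that P1[of e m] P3[of e m e' n] by (cases "e' = e0") auto
    qed
    ultimately have "P (c (i, rank))" by (auto simp: P_def e0(3) simp del: fun_upd_apply)
    moreover have "{e \<in> E. ?rank e = None} = {e \<in> E. rank e = None} - {e0}" by auto
    then have "card {e \<in> E. ?rank e = None} < card {e \<in> E. rank e = None}"
      using e0(1,2) fin by (metis (mono_tags, lifting) card_Diff1_less finite_subset mem_Collect_eq subsetI)
    ultimately show ?thesis using e0(3) by (simp del: fun_upd_apply)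
  qed
  have init: "P (0, Map.empty)" by (simp add: P_def)
  have exit: "\<forall>e\<in>E. \<forall>e'\<in>E. edge_less pos e e' \<longrightarrow> the (snd s e) < the (snd s e')"
    if s: "P s" "\<not> b s" for s
  proof (intro ballI impI)
    fix e e' assume e: "e \<in> E" "e' \<in> E" and less: "edge_less pos e e'"
    obtain i rank where irank: "s = (i, rank)" by fastforce
    have "rank e \<noteq> None" "rank e' \<noteq> None" using s(2) e by (auto simp: b_def irank)
    then obtain m n where mn: "rank e = Some m" "rank e' = Some n" by blast
    then have "m < n" using s(1) less unfolding P_def irank prod.case by blast
    then show "the (snd s e) < the (snd s e')" using mn by (simp add: irank)
  qed
  have "\<forall>e\<in>E. \<forall>e'\<in>E. edge_less pos e e' \<longrightarrow>
    the (snd (while b c (0, Map.empty)) e) < the (snd (while b c (0, Map.empty)) e')"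
  proof (rule while_rule2[where P = P and r = ?r, OF init _ exit])
    show "P (c s) \<and> (c s, s) \<in> ?r" if "P s" "b s" for s
      using body[of "fst s" "snd s"] that unfolding prod.collapse by blast
  qed simp_all
  then show ?thesis by (simp add: order_edges_def b_def c_def)
qed

section \<open>The labels at a node after its treatment\<close>

text \<open>Only the set of the visited nodes matters, hence not the order of the visits. The edge
  from x itself is exempt from the effect of step 7, since the concluding step relabels it in any
  case.\<close>

lemma process_edge_eq:
  assumes "(x, y) \<in> E"
  shows "process_edge E x y ws L (u, v) =
    (if v = y \<and> (u, v) \<in> E then
       if (\<exists>w\<in>set ws. (w, y) \<notin> E) \<or> u \<noteq> x \<and> u \<in> set ws then Compelled
       else if u = x \<or> L (u, v) = Unknown then
         if \<exists>z. (z, y) \<in> E \<and> z \<noteq> x \<and> (z, x) \<notin> E then Compelled else Reversible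
       else L (u, v)
     else L (u, v))"
  using assms
proof (induction ws arbitrary: L)
  case Nil
  then show ?case by (auto simp: relabel_def edges_into_def)
next
  case (Cons w ws)
  show ?case
  proof (cases "(w, y) \<in> E")
    case True
    then have eq: "process_edge E x y (w # ws) L = process_edge E x y ws (relabel {(w, y)} Compelled L)"
      by simp
    show ?thesis unfolding eq Cons.IH[OF Cons.prems]
      using True by (cases "v = y \<and> (u, v) \<in> E") (auto simp: relabel_def)
  next
    case False
    then show ?thesis using Cons.prems by (auto simp: relabel_def edges_into_def)
  qed
qed

text \<open>The labels at y as a function of those at its highest parent x. The latter are required
  to be known, so that later passes leave them unchanged.\<close>

definition settled :: "('a \<times> 'a) set \<Rightarrow> 'a labelling \<Rightarrow> 'a \<Rightarrow> bool" where
  "settled E L y \<longleftrightarrow> (\<exists>x. (x, y) \<in> E \<and> (\<forall>z. (z, y) \<in> E \<longrightarrow> (x, z) \<notin> E) \<and>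
     (\<forall>w. (w, x) \<in> E \<longrightarrow> L (w, x) \<noteq> Unknown) \<and>
     (\<forall>u. (u, y) \<in> E \<longrightarrow> L (u, y) =
       (if (\<exists>w. (w, x) \<in> E \<and> L (w, x) = Compelled \<and> (w, y) \<notin> E) \<or>
           (\<exists>z. (z, y) \<in> E \<and> z \<noteq> x \<and> (z, x) \<notin> E) \<or> (u, x) \<in> E \<and> L (u, x) = Compelled
        then Compelled else Reversible)))"

lemma settled_known: "settled E L y \<Longrightarrow> (u, y) \<in> E \<Longrightarrow> L (u, y) \<noteq> Unknown"
  by (auto simp: settled_def split: if_split_asm)

text \<open>The highest parent of v is not y, since its incoming edges are known while x
  \<rightarrow> y is unknown. So changes at y affect neither side of the equations for v.\<close>

lemma settled_cong:
  assumes "settled E L v" "(x, y) \<in> E" "L (x, y) = Unknown"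
    and "\<And>u w. w \<noteq> y \<Longrightarrow> L' (u, w) = L (u, w)" "v \<noteq> y"
  shows "settled E L' v"
proof -
  from assms(1) obtain x' where *: "(x', v) \<in> E" "\<forall>z. (z, v) \<in> E \<longrightarrow> (x', z) \<notin> E"
    "\<forall>w. (w, x') \<in> E \<longrightarrow> L (w, x') \<noteq> Unknown"
    "\<forall>u. (u, v) \<in> E \<longrightarrow> L (u, v) =
       (if (\<exists>w. (w, x') \<in> E \<and> L (w, x') = Compelled \<and> (w, v) \<notin> E) \<or>
           (\<exists>z. (z, v) \<in> E \<and> z \<noteq> x' \<and> (z, x') \<notin> E) \<or> (u, x') \<in> E \<and> L (u, x') = Compelled
        then Compelled else Reversible)" unfolding settled_def by blast
  have "x' \<noteq> y" using *(3) assms(2,3) by blast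
  then have "L' (u, x') = L (u, x')" "L' (u, v) = L (u, v)" for u using assms(4,5) by auto
  then show ?thesis unfolding settled_def using * by (intro exI[of _ x']) simp
qed

lemma find_compelled_settled:
  fixes pos :: "'a \<Rightarrow> nat"
  assumes fin: "finite E" and EU: "E \<subseteq> set ts \<times> set ts" and inj: "inj_on pos (set ts)"
    and sorted: "sorted_wrt (\<lambda>a b. pos a < pos b) ts"
    and pos: "\<And>a b. (a, b) \<in> E \<Longrightarrow> pos a < pos b"
    and scan: "\<And>e. e \<in> E \<Longrightarrow> set (scan e) = set ts"
  shows "\<forall>(x, y)\<in>E. settled E (find_compelled E ts scan) y"
proof -
  define rank where "rank = order_edges E ts"
  define b :: "'a labelling \<Rightarrow> bool" where "b = (\<lambda>L. \<exists>e\<in>E. L e = Unknown)"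
  define c where "c = (\<lambda>L. let (x, y) = arg_min_on (\<lambda>e. the (rank e)) {e \<in> E. L e = Unknown} in
    process_edge E x y (filter (\<lambda>w. (w, x) \<in> E \<and> L (w, x) = Compelled) (scan (x, y))) L)"
  \<comment> \<open>Invariant: a known edge has a settled target, and this target precedes the
    targets of all unknown edges.\<close>
  define P where "P = (\<lambda>L. (\<forall>(x, y)\<in>E. L (x, y) = Unknown \<or> settled E L y) \<and>
    (\<forall>e\<in>E. \<forall>e'\<in>E. L e \<noteq> Unknown \<longrightarrow> L e' = Unknown \<longrightarrow> pos (snd e) < pos (snd e')))"
  have "P (c L) \<and> (c L, L) \<in> inv_image less_than (\<lambda>L. card {e \<in> E. L e = Unknown})"
    if P: "P L" and b: "b L" for L
  proof -
    let ?S = "{e \<in> E. L e = Unknown}"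
    obtain x y where xy: "arg_min_on (\<lambda>e. the (rank e)) ?S = (x, y)" by fastforce
    have "finite ?S" "?S \<noteq> {}" using fin b by (auto simp: b_def)
    from arg_min_if_finite[OF this, of "\<lambda>e. the (rank e)"]
    have xyS: "(x, y) \<in> E" "L (x, y) = Unknown"
      and "\<And>e. e \<in> ?S \<Longrightarrow> \<not> the (rank e) < the (rank (x, y))" by (auto simp: xy)
    then have min: "\<not> edge_less pos e (x, y)" if "e \<in> E" "L e = Unknown" for e
      using order_edges_lexicographic[OF fin EU inj sorted] that unfolding rank_def by blast
    from P have known: "\<And>u v. (u, v) \<in> E \<Longrightarrow> L (u, v) = Unknown \<or> settled E L v"
      and lower: "\<And>e e'. e \<in> E \<Longrightarrow> e' \<in> E \<Longrightarrow> L e \<noteq> Unknown \<Longrightarrow> L e' = Unknown \<Longrightarrow> pos (snd e) < pos (snd e')"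
      by (auto simp: P_def)
    \<comment> \<open>One known edge into y would settle y and make x \<rightarrow> y known. So a
      pass finds all edges into y unknown and, as x precedes y, all edges into x known.\<close>
    have into_y: "L (u, y) = Unknown" if "(u, y) \<in> E" for u
      using known[OF that] settled_known[of E L y x] xyS by blast
    have into_x: "L (w, x) \<noteq> Unknown" if "(w, x) \<in> E" for w
      using min[OF that] pos[OF xyS(1)] by (auto simp: edge_less_def)
    have highest: "(x, z) \<notin> E" if "(z, y) \<in> E" for z
      using min[OF that into_y[OF that]] pos[of x z] by (auto simp: edge_less_def)
    have nx: "(x, x) \<notin> E" using pos by blast
    define C where "C w \<longleftrightarrow> (w, x) \<in> E \<and> L (w, x) = Compelled" for w
    have ws: "set (filter C (scan (x, y))) = {w. C w}"
      using scan[OF xyS(1)] EU by (auto simp: C_def)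
    have cL: "c L (u, v) = (if v = y \<and> (u, v) \<in> E then
        if (\<exists>w. C w \<and> (w, y) \<notin> E) \<or> (\<exists>z. (z, y) \<in> E \<and> z \<noteq> x \<and> (z, x) \<notin> E) \<or> C u
        then Compelled else Reversible else L (u, v))" for u v
    proof -
      have eq: "c L = process_edge E x y (filter C (scan (x, y))) L"
        unfolding c_def xy C_def by simp
      have "\<not> C x" using nx by (simp add: C_def)
      then show ?thesis using into_y unfolding eq process_edge_eq[OF xyS(1)] ws by auto
    qed
    have other: "c L (u, v) = L (u, v)" if "v \<noteq> y" for u v using that by (simp add: cL)
    have "x \<noteq> y" using xyS nx by blast
    have sy: "settled E (c L) y"
      unfolding settled_def
    proof (intro exI[of _ x] conjI allI impI)
      show "c L (w, x) \<noteq> Unknown" if "(w, x) \<in> E" for w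
        using that into_x other \<open>x \<noteq> y\<close> by simp
      show "c L (u, y) = (if (\<exists>w. (w, x) \<in> E \<and> c L (w, x) = Compelled \<and> (w, y) \<notin> E) \<or>
           (\<exists>z. (z, y) \<in> E \<and> z \<noteq> x \<and> (z, x) \<notin> E) \<or> (u, x) \<in> E \<and> c L (u, x) = Compelled
        then Compelled else Reversible)" if "(u, y) \<in> E" for u
        unfolding other[OF \<open>x \<noteq> y\<close>] cL[of u y] using that by (simp add: C_def)
    qed (use xyS highest in auto)
    have "c L (u, v) = Unknown \<or> settled E (c L) v" if "(u, v) \<in> E" for u v
    proof (cases "v = y")
      case False
      have "settled E (c L) v" if "settled E L v"
        by (rule settled_cong[OF that xyS _ False]) (rule other)
      then show ?thesis using known[OF that] other[OF False, of u] by auto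
    qed (use sy in simp)
    moreover have "pos (snd e) < pos (snd e')"
      if "e \<in> E" "e' \<in> E" "c L e \<noteq> Unknown" "c L e' = Unknown" for e e'
    proof -
      have "snd e' \<noteq> y" using that(2,4) settled_known[OF sy, of "fst e'"] by auto
      then have e': "L e' = Unknown" using that(4) other[of "snd e'" "fst e'"] by simp
      show ?thesis
      proof (cases "snd e = y")
        case True
        have "pos (snd e') \<noteq> pos y"
          using \<open>snd e' \<noteq> y\<close> inj subsetD[OF EU that(2)] subsetD[OF EU xyS(1)]
          by (simp add: inj_on_eq_iff mem_Times_iff)
        then show ?thesis using min[OF that(2) e'] True by (auto simp: edge_less_def)
      next
        case False
        then have "L e \<noteq> Unknown" using that(3) other[of "snd e" "fst e"] by simp
        then show ?thesis using lower that e' by blast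
      qed
    qed
    ultimately have "P (c L)" by (auto simp: P_def)
    moreover have "{e \<in> E. c L e = Unknown} \<subset> ?S"
    proof
      show "{e \<in> E. c L e = Unknown} \<subseteq> ?S" using cL by (auto split: if_splits)
      show "{e \<in> E. c L e = Unknown} \<noteq> ?S" using xyS settled_known[OF sy xyS(1)] by auto
    qed
    then have "card {e \<in> E. c L e = Unknown} < card ?S" using fin by (intro psubset_card_mono) auto
    ultimately show ?thesis by simp
  qed
  moreover have "P (\<lambda>e. Unknown)" by (auto simp: P_def)
  moreover have "\<forall>(x, y)\<in>E. settled E L y" if "P L" "\<not> b L" for L
    using that by (auto simp: P_def b_def)
  ultimately have "\<forall>(x, y)\<in>E. settled E (while b c (\<lambda>e. Unknown)) y"
    by (intro while_rule2[where P = P and b = b and c = c and Q = "\<lambda>L. \<forall>(x, y)\<in>E. settled E L y" and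
          r = "inv_image less_than (\<lambda>L. card {e \<in> E. L e = Unknown})"]) simp_all
  then show ?thesis by (simp add: find_compelled_def b_def c_def rank_def)
qed

text \<open>If the condition of step 6 or 8 holds at y, the equations make every edge into y
  compelled. Otherwise all compelled parents of x are parents of y, and the equations make them the
  compelled parents of y.\<close>

lemma settled_imp_labelled:
  assumes "\<forall>(x, y)\<in>E. settled E L y"
  shows "labelled E {e \<in> E. L e = Compelled}"
  unfolding labelled_def
proof (intro conjI allI impI)
  fix y assume "parents E y \<noteq> {}"
  then have "settled E L y" using assms by auto
  then obtain x where *: "(x, y) \<in> E" "\<forall>z. (z, y) \<in> E \<longrightarrow> (x, z) \<notin> E"
    "\<And>u. (u, y) \<in> E \<Longrightarrow> L (u, y) =
       (if (\<exists>w. (w, x) \<in> E \<and> L (w, x) = Compelled \<and> (w, y) \<notin> E) \<or>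
           (\<exists>z. (z, y) \<in> E \<and> z \<noteq> x \<and> (z, x) \<notin> E) \<or> (u, x) \<in> E \<and> L (u, x) = Compelled
        then Compelled else Reversible)" unfolding settled_def by blast
  show "\<exists>x. (x, y) \<in> E \<and> (\<forall>z. (z, y) \<in> E \<longrightarrow> (x, z) \<notin> E) \<and>
       ((\<forall>z. (z, y) \<in> E \<longrightarrow> (z, y) \<in> {e \<in> E. L e = Compelled}) \<and>
          ((\<exists>w. (w, x) \<in> {e \<in> E. L e = Compelled} \<and> (w, y) \<notin> E) \<or> (\<exists>z. (z, y) \<in> E \<and> z \<noteq> x \<and> (z, x) \<notin> E)) \<or>
        (\<forall>w. (w, y) \<in> {e \<in> E. L e = Compelled} \<longleftrightarrow> (w, x) \<in> {e \<in> E. L e = Compelled}) \<and>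
        (\<forall>z. (z, y) \<in> E \<and> z \<noteq> x \<longrightarrow> (z, x) \<in> E))"
  proof (cases "(\<exists>w. (w, x) \<in> E \<and> L (w, x) = Compelled \<and> (w, y) \<notin> E) \<or>
      (\<exists>z. (z, y) \<in> E \<and> z \<noteq> x \<and> (z, x) \<notin> E)")
    case True
    then have "\<forall>z. (z, y) \<in> E \<longrightarrow> L (z, y) = Compelled" using *(3) by auto
    then show ?thesis using True *(1,2) by (intro exI[of _ x]) auto
  next
    case False
    then have "L (u, y) = (if (u, x) \<in> E \<and> L (u, x) = Compelled then Compelled else Reversible)"
      if "(u, y) \<in> E" for u using *(3)[OF that] by auto
    then show ?thesis using False *(1,2) by (intro exI[of _ x] conjI disjI2) (auto split: if_split_asm)
  qed
qed auto

section \<open>Correctness of the labels\<close>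

lemma topological_sort_position:
  assumes "topological_sort U E ts" "E \<subseteq> U \<times> U"
  shows "\<exists>pos :: 'a \<Rightarrow> nat. inj_on pos (set ts) \<and> sorted_wrt (\<lambda>a b. pos a < pos b) ts \<and>
    (\<forall>a b. (a, b) \<in> E \<longrightarrow> pos a < pos b)"
proof -
  define pos where "pos = inv_into {..<length ts} ((!) ts)"
  have ts: "distinct ts" "set ts = U"
    "\<And>i j. i < length ts \<Longrightarrow> j < length ts \<Longrightarrow> (ts ! i, ts ! j) \<in> E\<^sup>+ \<Longrightarrow> i < j"
    using assms(1) by (auto simp: topological_sort_def)
  have pos: "pos (ts ! i) = i" if "i < length ts" for i
    unfolding pos_def using that ts(1) by (intro inv_into_f_f inj_on_nth) auto
  have "inj_on pos (set ts)"
    by (rule inj_onI) (metis in_set_conv_nth pos)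
  moreover have "sorted_wrt (\<lambda>a b. pos a < pos b) ts"
    unfolding sorted_wrt_iff_nth_less using pos by simp
  moreover have "pos a < pos b" if ab: "(a, b) \<in> E" for a b
  proof -
    have "a \<in> set ts" "b \<in> set ts" using ab assms(2) ts(2) by auto
    then obtain i j where "i < length ts" "a = ts ! i" "j < length ts" "b = ts ! j"
      by (metis in_set_conv_nth)
    then show ?thesis using ts(3)[of i j] ab pos by auto
  qed
  ultimately show ?thesis by blast
qed

text \<open>The neighbours of v behind it in the list are reversible parents of v, which are
  pairwise adjacent by \<open>labelled_clique\<close>.\<close>

lemma labelled_perfect:
  assumes "labelled E C" "wf E" "sorted_wrt (\<lambda>v a. (v, a) \<notin> E) xs"
  shows "perfect (skeleton (E - C)) xs"
  using assms(3)
proof (induction xs)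
  case (Cons v xs)
  have "(a, b) \<in> skeleton (E - C)"
    if "a \<in> set xs" "b \<in> set xs" "(a, v) \<in> skeleton (E - C)" "(b, v) \<in> skeleton (E - C)" "a \<noteq> b" for a b
    using that Cons.prems labelled_clique[OF assms(1,2), of a v b] by (auto simp: skeleton_iff)
  then show ?case using Cons by simp
qed simp

theorem theorem10:
  fixes U :: "'a set" and r :: "'a \<Rightarrow> nat" and E :: "('a \<times> 'a) set"
    and ts :: "'a list" and scan :: "'a \<times> 'a \<Rightarrow> 'a list"
  assumes "finite U"
    and "\<And>x. x \<in> U \<Longrightarrow> 2 \<le> r x"
    and "dag U E"
    and "topological_sort U E ts"
    and "\<And>e. e \<in> E \<Longrightarrow> distinct (scan e) \<and> set (scan e) = U"
  shows "\<forall>e\<in>E.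
    (find_compelled E ts scan e = Compelled \<longrightarrow> compelled U r E e) \<and>
    (find_compelled E ts scan e = Reversible \<longrightarrow> reversible U r E e)"
proof -
  let ?C = "{e \<in> E. find_compelled E ts scan e = Compelled}"
  have EU: "E \<subseteq> U \<times> U" and ac: "acyclic E" using assms(3) by (auto simp: dag_def)
  have fin: "finite E" using EU assms(1) by (auto intro: finite_subset)
  have wf: "wf E" using fin ac by (rule finite_acyclic_wf)
  have ts: "distinct ts" "set ts = U" using assms(4) by (auto simp: topological_sort_def)
  obtain pos :: "'a \<Rightarrow> nat" where pos: "inj_on pos (set ts)" "sorted_wrt (\<lambda>a b. pos a < pos b) ts"
    "\<And>a b. (a, b) \<in> E \<Longrightarrow> pos a < pos b"
    using topological_sort_position[OF assms(4) EU] by blast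
  have "\<forall>(x, y)\<in>E. settled E (find_compelled E ts scan) y"
    using find_compelled_settled[OF fin _ pos(1,2), of scan] EU ts(2) pos(3) assms(5) by blast
  then have lab: "labelled E ?C" by (rule settled_imp_labelled)
  \<comment> \<open>The topological sort is reversed because edges point from later to earlier
    entries in the lists of \<open>perfect\<close>.\<close>
  have "sorted_wrt (\<lambda>v a. (v, a) \<notin> E) (rev ts)"
    unfolding sorted_wrt_rev using pos(2)
    by (rule sorted_wrt_mono_rel[rotated]) (use pos(3) in fastforce)
  then have perfect: "perfect (skeleton (E - ?C)) (rev ts)"
    using labelled_perfect[OF lab wf] by blast
  have "compelled U r E (a, b)" if "(a, b) \<in> ?C" for a b
    unfolding compelled_def
  proof (intro conjI allI impI)
    fix E' assume E': "dag U E' \<and> dag_equiv U r E E'"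
    then have "acyclic E'" by (simp add: dag_def)
    then show "(a, b) \<in> E'"
      using labelled_sound[OF lab wf ac _ dag_equiv_skeleton dag_equiv_v_structures that] assms(1,2) E'
      by blast
  qed (use that in simp)
  moreover have "reversible U r E (a, b)"
    if "(a, b) \<in> E" "find_compelled E ts scan (a, b) = Reversible" for a b
  proof -
    have "(a, b) \<in> E - ?C" using that by simp
    from reorient[OF lab wf ac EU _ _ perfect this] ts
    obtain E' where E': "E' \<subseteq> U \<times> U" "acyclic E'" "skeleton E = skeleton E'"
      "v_structures E = v_structures E'" "(a, b) \<notin> E'" by auto
    then have "dag U E'" by (simp add: dag_def)
    moreover from this have "dag_equiv U r E E'"
      using markov_equivalent_imp_dag_equiv assms(1,3) E'(3,4) by blast
    ultimately show ?thesis using that(1) E'(5) by (auto simp: reversible_def compelled_def)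
  qed
  ultimately show ?thesis by auto
qed

end
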